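(* For every $n\in\mathbb{N}$, the Baumslag-Solitar group $B(1,n)=\langle a,b\mid a^{-1}ba=b^n\rangle$ is graph automatic.
   Context: $\mathbb{N}=\{0,1,2,\dots\}$. For a finite alphabet $\Sigma$, let $\Sigma^\star$ be the set of finite strings over $\Sigma$. For strings $w_1,\dots,w_n\in\Sigma^\star$ the convolution $\otimes(w_1,\dots,w_n)$ is the string of length $\max_i|w_i|$ over the alphabet $(\Sigma\cup\{\diamond\})^n$ (with $\diamond\notin\Sigma$) whose $k$-th symbol is $(\sigma_1,\dots,\sigma_n)$, where $\sigma_i$ is the $k$-th symbol of $w_i$ if $k\le|w_i|$ and $\sigma_i=\diamond$ otherwise. A relation $R\subseteq(\Sigma^\star)^n$ is FA recognizable if $\{\otimes(w_1,\dots,w_n)\mid (w_1,\dots,w_n)\in R\}$ is a regular language (recognized by a finite automaton). Let $G$ be a group generated by a finite set $X$. Its Cayley graph $\Gamma(G,X)$ is viewed as the structure $(G;(E_x)_{x\in X})$ with $E_x=\{(g,gx)\mid g\in G\}$. The group $G$ is graph automatic with respect to $X$ if there are a finite alphabet $\Sigma$, a regular language $R\subseteq\Sigma^\star$ and a bijection $\nu:R\to G$ such that for each $x\in X$ the relation $\{(u,v)\in R^2\mid \nu(u)x=\nu(v)\}$ is FA recognizable. A finitely generated group is graph automatic if it is graph automatic with respect to some finite generating set. *)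

theory Defs
  imports "HOL-Algebra.Generated_Groups"
begin

section \<open>Finite automata and regular languages\<close>

inductive nfa_path :: "('s \<times> 'a \<times> 's) set \<Rightarrow> 's \<Rightarrow> 'a list \<Rightarrow> 's \<Rightarrow> bool"
  for \<Delta> :: "('s \<times> 'a \<times> 's) set" where
  Nil: "nfa_path \<Delta> p [] p"
| Cons: "(p, x, q) \<in> \<Delta> \<Longrightarrow> nfa_path \<Delta> q w r \<Longrightarrow> nfa_path \<Delta> p (x # w) r"

text \<open>
  Automata may be nondeterministic and partial. Since every finite set embeds into the natural
  numbers, taking the states to be natural numbers is no restriction.
\<close>

definition regular :: "'a set \<Rightarrow> 'a list set \<Rightarrow> bool" where
  "regular \<Sigma> L \<longleftrightarrow> finite \<Sigma> \<and>
     (\<exists>(Q :: nat set) I \<Delta> F. finite Q \<and> I \<subseteq> Q \<and> F \<subseteq> Q \<and> \<Delta> \<subseteq> Q \<times> \<Sigma> \<times> Q \<and>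
        L = {w \<in> lists \<Sigma>. \<exists>p\<in>I. \<exists>q\<in>F. nfa_path \<Delta> p w q})"


section \<open>Convolution and FA recognizable relations\<close>

text \<open>
  An \<open>n\<close>-tuple of strings is a list of length \<open>n\<close>. The padding symbol \<open>\<diamond>\<close> is \<^term>\<open>None\<close>, and a
  symbol \<open>\<sigma>\<close> of the alphabet becomes \<^term>\<open>Some \<sigma>\<close>.
\<close>

definition convolution :: "'a list list \<Rightarrow> 'a option list list" where
  "convolution ws =
     map (\<lambda>k. map (\<lambda>w. if k < length w then Some (w ! k) else None) ws)
       [0..<Max (insert 0 (length ` set ws))]"

definition padded_alphabet :: "'a set \<Rightarrow> nat \<Rightarrow> 'a option list set" where
  "padded_alphabet \<Sigma> n = {c. length c = n \<and> set c \<subseteq> insert None (Some ` \<Sigma>)}"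

definition FA_recognizable :: "'a set \<Rightarrow> nat \<Rightarrow> 'a list list set \<Rightarrow> bool" where
  "FA_recognizable \<Sigma> n R \<longleftrightarrow>
     R \<subseteq> {ws. length ws = n \<and> set ws \<subseteq> lists \<Sigma>} \<and>
     regular (padded_alphabet \<Sigma> n) (convolution ` R)"


section \<open>Graph automatic groups\<close>

text \<open>As for states, the finite alphabet can be taken to consist of natural numbers.\<close>

definition graph_automatic_wrt :: "('g, 'm) monoid_scheme \<Rightarrow> 'g set \<Rightarrow> bool" where
  "graph_automatic_wrt G X \<longleftrightarrow>
     group G \<and> finite X \<and> X \<subseteq> carrier G \<and> generate G X = carrier G \<and>
     (\<exists>(\<Sigma> :: nat set) R \<nu>. finite \<Sigma> \<and> regular \<Sigma> R \<and> bij_betw \<nu> R (carrier G) \<and>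
        (\<forall>x\<in>X. FA_recognizable \<Sigma> 2 {[u, v] | u v. u \<in> R \<and> v \<in> R \<and> \<nu> u \<otimes>\<^bsub>G\<^esub> x = \<nu> v}))"

definition graph_automatic :: "('g, 'm) monoid_scheme \<Rightarrow> bool" where
  "graph_automatic G \<longleftrightarrow> (\<exists>X. graph_automatic_wrt G X)"


section \<open>Group presentations\<close>

datatype 'x letter = Gen 'x | GInv 'x

fun inv_letter :: "'x letter \<Rightarrow> 'x letter" where
  "inv_letter (Gen x) = GInv x"
| "inv_letter (GInv x) = Gen x"

text \<open>
  The group with generators \<^term>\<open>UNIV :: 'x set\<close> and defining relations \<open>r = s\<close> for
  \<open>(r, s) \<in> S\<close> is the quotient of the monoid of words in the generators and their formal inverses
  by the least congruence that contains \<open>S\<close> and cancels every letter against its inverse.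
\<close>

inductive_set word_cong :: "('x letter list \<times> 'x letter list) set \<Rightarrow>
    ('x letter list \<times> 'x letter list) set"
  for S :: "('x letter list \<times> 'x letter list) set" where
  refl: "(u, u) \<in> word_cong S"
| sym: "(u, v) \<in> word_cong S \<Longrightarrow> (v, u) \<in> word_cong S"
| trans: "(u, v) \<in> word_cong S \<Longrightarrow> (v, w) \<in> word_cong S \<Longrightarrow> (u, w) \<in> word_cong S"
| cancel: "(u @ [x, inv_letter x] @ v, u @ v) \<in> word_cong S"
| rel: "(r, s) \<in> S \<Longrightarrow> (u @ r @ v, u @ s @ v) \<in> word_cong S"

definition presented_group ::
    "('x letter list \<times> 'x letter list) set \<Rightarrow> 'x letter list set monoid" where
  "presented_group S =
     \<lparr>carrier = UNIV // word_cong S,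
      mult = (\<lambda>A B. \<Union>u\<in>A. \<Union>v\<in>B. word_cong S `` {u @ v}),
      one = word_cong S `` {[]}\<rparr>"

lemma equiv_word_cong: "equiv UNIV (word_cong S)"
  by (intro equivI refl_onI symI transI) (auto intro: word_cong.intros)

lemma word_cong_append_left: "(u, v) \<in> word_cong S \<Longrightarrow> (w @ u, w @ v) \<in> word_cong S"
proof (induction rule: word_cong.induct)
  case (cancel u x v)
  then show ?case using word_cong.cancel[of "w @ u" x v S] by simp
next
  case (rel r s u v)
  then show ?case using word_cong.rel[of r s S "w @ u" v] by simp
qed (blast intro: word_cong.intros)+

lemma word_cong_append_right: "(u, v) \<in> word_cong S \<Longrightarrow> (u @ w, v @ w) \<in> word_cong S"
proof (induction rule: word_cong.induct)
  case (cancel u x v)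
  then show ?case using word_cong.cancel[of u x "v @ w" S] by simp
next
  case (rel r s u v)
  then show ?case using word_cong.rel[of r s S u "v @ w"] by simp
qed (blast intro: word_cong.intros)+

lemma mult_presented_group:
  "word_cong S `` {u} \<otimes>\<^bsub>presented_group S\<^esub> word_cong S `` {v} = word_cong S `` {u @ v}"
proof -
  have "congruent2 (word_cong S) (word_cong S) (\<lambda>u v. word_cong S `` {u @ v})"
  proof (rule congruent2I[OF equiv_word_cong equiv_word_cong])
    show "word_cong S `` {y @ w} = word_cong S `` {z @ w}" if "(y, z) \<in> word_cong S" for y z w
      by (rule equiv_class_eq[OF equiv_word_cong word_cong_append_right[OF that]])
    show "word_cong S `` {w @ y} = word_cong S `` {w @ z}" if "(y, z) \<in> word_cong S" for y z w
      by (rule equiv_class_eq[OF equiv_word_cong word_cong_append_left[OF that]])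
  qed
  then show ?thesis
    by (simp add: presented_group_def UN_equiv_class2[OF equiv_word_cong equiv_word_cong])
qed

lemma word_cong_inverse: "(map inv_letter (rev u) @ u, []) \<in> word_cong S"
proof (induction u)
  case Nil
  then show ?case by (simp add: word_cong.refl)
next
  case (Cons x u)
  have "inv_letter (inv_letter x) = x"
    by (cases x) auto
  then have "(map inv_letter (rev u) @ [inv_letter x, x] @ u, map inv_letter (rev u) @ u)
      \<in> word_cong S"
    using word_cong.cancel[of "map inv_letter (rev u)" "inv_letter x" u S] by simp
  with Cons show ?case by (auto intro: word_cong.trans)
qed

lemma group_presented_group: "group (presented_group S)"
proof (rule groupI)
  have c: "A \<in> carrier (presented_group S) \<longleftrightarrow> (\<exists>u. A = word_cong S `` {u})" for A
    by (auto simp: presented_group_def quotient_def)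
  have o: "\<one>\<^bsub>presented_group S\<^esub> = word_cong S `` {[]}"
    by (simp add: presented_group_def)
  show "\<one>\<^bsub>presented_group S\<^esub> \<in> carrier (presented_group S)"
    using c o by blast
  fix A assume "A \<in> carrier (presented_group S)"
  then obtain u where u: "A = word_cong S `` {u}" using c by blast
  show "\<one>\<^bsub>presented_group S\<^esub> \<otimes>\<^bsub>presented_group S\<^esub> A = A"
    by (simp add: o u mult_presented_group)
  have "word_cong S `` {map inv_letter (rev u)} \<otimes>\<^bsub>presented_group S\<^esub> A = \<one>\<^bsub>presented_group S\<^esub>"
    unfolding o u mult_presented_group
    by (rule equiv_class_eq[OF equiv_word_cong word_cong_inverse])
  then show "\<exists>B\<in>carrier (presented_group S). B \<otimes>\<^bsub>presented_group S\<^esub> A = \<one>\<^bsub>presented_group S\<^esub>"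
    using c by blast
  fix B assume "B \<in> carrier (presented_group S)"
  then obtain v where v: "B = word_cong S `` {v}" using c by blast
  show "A \<otimes>\<^bsub>presented_group S\<^esub> B \<in> carrier (presented_group S)"
    unfolding u v mult_presented_group c by blast
  fix C assume "C \<in> carrier (presented_group S)"
  then obtain w where w: "C = word_cong S `` {w}" using c by blast
  show "A \<otimes>\<^bsub>presented_group S\<^esub> B \<otimes>\<^bsub>presented_group S\<^esub> C =
      A \<otimes>\<^bsub>presented_group S\<^esub> (B \<otimes>\<^bsub>presented_group S\<^esub> C)"
    unfolding u v w mult_presented_group by simp
qed


section \<open>Baumslag-Solitar groups\<close>

datatype bs_gen = gen_a | gen_b

definition Baumslag_Solitar :: "nat \<Rightarrow> nat \<Rightarrow> bs_gen letter list set monoid" where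
  "Baumslag_Solitar m n =
     presented_group
       {([GInv gen_a] @ replicate m (Gen gen_b) @ [Gen gen_a], replicate n (Gen gen_b))}"

end

theory Submission
  imports Defs "HOL-Library.Countable"
begin

text \<open>
  Since \<open>ba = ab\<^sup>n\<close>, every element of \<open>B(1, n)\<close> has a unique form \<open>a\<^sup>i b\<^sup>k a\<^bsup>-j\<^esup>\<close> with \<open>i, j \<ge> 0\<close>
  and \<open>i = 0\<close>, \<open>j = 0\<close> or \<open>n\<close> not dividing \<open>k\<close> (and \<open>k = 0\<close> if \<open>n = 0\<close>). Right multiplication by \<open>a\<close>
  turns \<open>(i, k, j)\<close> into \<open>(i, k, j - 1)\<close> or, for \<open>j = 0\<close>, into \<open>(i + 1, nk, 0)\<close>; right multiplication
  by \<open>b\<close> turns \<open>k\<close> into \<open>k + n\<^sup>j\<close>. The triple is encoded by the sequence of letters whose \<open>p\<close>-th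
  member records whether \<open>p < i\<close>, whether \<open>p < j\<close>, and the \<open>p\<close>-th digit of \<open>k\<close> in base \<open>max 2 n\<close>.
  Negative \<open>k\<close> have digits that are eventually \<open>max 2 n - 1\<close>, so all these sequences are eventually
  constant. Both multiplications become a shift or an addition with carry, and are
  therefore described by conditions on consecutive letters, which a finite automaton checks.
\<close>

section \<open>Right congruences of finite index\<close>

lemma nfa_path_Nil_iff: "nfa_path \<Delta> p [] q \<longleftrightarrow> p = q"
  by (auto intro: nfa_path.Nil elim: nfa_path.cases)

lemma nfa_path_Cons_iff: "nfa_path \<Delta> p (x # w) q \<longleftrightarrow> (\<exists>r. (p, x, r) \<in> \<Delta> \<and> nfa_path \<Delta> r w q)"
  by (auto intro: nfa_path.Cons elim: nfa_path.cases)

lemma nfa_path_snoc_iff: "nfa_path \<Delta> p (w @ [x]) q \<longleftrightarrow> (\<exists>r. nfa_path \<Delta> p w r \<and> (r, x, q) \<in> \<Delta>)"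
  by (induction w arbitrary: p) (auto simp: nfa_path_Cons_iff nfa_path_Nil_iff)

text \<open>One half of Myhill-Nerode: the values of \<open>h\<close> serve as states of a
  deterministic automaton. By \<open>cong\<close> its transitions are well defined, and by
  \<open>acc\<close> acceptance depends on the value only.\<close>

lemma regularI_congruence:
  fixes h :: "'a list \<Rightarrow> 'b"
  assumes fin: "finite \<Sigma>" "finite (h ` lists \<Sigma>)"
    and sub: "L \<subseteq> lists \<Sigma>"
    and cong: "\<And>v w x. v \<in> lists \<Sigma> \<Longrightarrow> w \<in> lists \<Sigma> \<Longrightarrow> x \<in> \<Sigma> \<Longrightarrow> h v = h w \<Longrightarrow> h (v @ [x]) = h (w @ [x])"
    and acc: "\<And>v w. v \<in> L \<Longrightarrow> w \<in> lists \<Sigma> \<Longrightarrow> h v = h w \<Longrightarrow> w \<in> L"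
  shows "regular \<Sigma> L"
proof -
  \<comment> \<open>States have to be natural numbers, so the finitely many values of
    \<open>h\<close> are numbered.\<close>
  obtain f :: "'b \<Rightarrow> nat" where f: "inj_on f (h ` lists \<Sigma>)"
    using finite_imp_inj_to_nat_seg[OF fin(2)] by blast
  define g where "g w = f (h w)" for w
  have g_eq: "h v = h w" if "g v = g w" "v \<in> lists \<Sigma>" "w \<in> lists \<Sigma>" for v w
    using f that unfolding g_def by (meson imageI inj_onD)
  define \<Delta> where "\<Delta> = {(g w, x, g (w @ [x])) | w x. w \<in> lists \<Sigma> \<and> x \<in> \<Sigma>}"
  have step: "(g w, x, r) \<in> \<Delta> \<longleftrightarrow> r = g (w @ [x])" if "w \<in> lists \<Sigma>" "x \<in> \<Sigma>" for w x r
  proof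
    assume "(g w, x, r) \<in> \<Delta>"
    then obtain v where v: "g w = g v" "r = g (v @ [x])" "v \<in> lists \<Sigma>"
      unfolding \<Delta>_def mem_Collect_eq prod.inject by (elim exE conjE) (rule that, simp_all)
    show "r = g (w @ [x])"
      using cong[OF that(1) v(3) that(2) g_eq[OF v(1) that(1) v(3)]] v(2) by (simp only: g_def)
  qed (use that in \<open>auto simp: \<Delta>_def\<close>)
  have path: "nfa_path \<Delta> (g []) w r \<longleftrightarrow> r = g w" if "w \<in> lists \<Sigma>" for w r
    using that by (induction w arbitrary: r rule: rev_induct) (auto simp: nfa_path_Nil_iff nfa_path_snoc_iff step)
  have "finite (g ` lists \<Sigma>)"
    using finite_imageI[OF fin(2), of f] by (simp add: g_def image_image)
  moreover have "L = {w \<in> lists \<Sigma>. \<exists>p\<in>{g []}. \<exists>q\<in>g ` L. nfa_path \<Delta> p w q}"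
  proof -
    have "(\<exists>q\<in>g ` L. nfa_path \<Delta> (g []) w q) \<longleftrightarrow> w \<in> L" if "w \<in> lists \<Sigma>" for w
      unfolding path[OF that] using acc[OF _ that] g_eq[OF _ _ that] sub by (metis image_iff subsetD)
    then show ?thesis
      using sub by blast
  qed
  moreover have "{g []} \<subseteq> g ` lists \<Sigma>" "g ` L \<subseteq> g ` lists \<Sigma>"
      "\<Delta> \<subseteq> g ` lists \<Sigma> \<times> \<Sigma> \<times> g ` lists \<Sigma>"
    using sub by (auto simp: \<Delta>_def intro!: imageI)
  ultimately show ?thesis
    unfolding regular_def using fin(1) by blast
qed

text \<open>Subset construction: \<open>h w\<close> is the set of states reachable from
  \<open>I\<close> along \<open>w\<close>, a subset of the finite set \<open>Q\<close>.\<close>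

lemma regularE_congruence:
  assumes "regular \<Sigma> L"
  obtains h :: "'a list \<Rightarrow> nat set"
  where "finite (range h)" "\<And>v w x. h v = h w \<Longrightarrow> h (v @ [x]) = h (w @ [x])"
    "\<And>v w. v \<in> L \<Longrightarrow> w \<in> lists \<Sigma> \<Longrightarrow> h v = h w \<Longrightarrow> w \<in> L"
proof -
  from assms obtain Q :: "nat set" and I \<Delta> F where Q: "finite Q" "I \<subseteq> Q" "\<Delta> \<subseteq> Q \<times> \<Sigma> \<times> Q"
    and L: "L = {w \<in> lists \<Sigma>. \<exists>p\<in>I. \<exists>q\<in>F. nfa_path \<Delta> p w q}"
    unfolding regular_def by blast
  define h where "h w = {q. \<exists>p\<in>I. nfa_path \<Delta> p w q}" for w
  have "h w \<subseteq> Q" for w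
    using Q by (cases w rule: rev_cases) (auto simp: h_def nfa_path_Nil_iff nfa_path_snoc_iff)
  then have "range h \<subseteq> Pow Q"
    by blast
  then have "finite (range h)"
    using Q(1) finite_subset by blast
  moreover have "h (v @ [x]) = {r. \<exists>q\<in>h v. (q, x, r) \<in> \<Delta>}" for v x
    by (auto simp: h_def nfa_path_snoc_iff)
  moreover have "w \<in> L \<longleftrightarrow> w \<in> lists \<Sigma> \<and> h w \<inter> F \<noteq> {}" for w
    by (auto simp: L h_def)
  ultimately show ?thesis
    by (intro that[of h]) auto
qed

section \<open>Finite words as eventually constant sequences\<close>

text \<open>Clamping the index repeats the last letter forever. On \<open>[]\<close> the value is
  the unspecified \<open>[] ! 0\<close>, so only nonempty words are used as codes.\<close>

definition unfold_word :: "'a list \<Rightarrow> nat \<Rightarrow> 'a" where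
  "unfold_word u p = u ! min p (length u - 1)"

text \<open>The condition also sees the first letter, where the lowest digit and the positivity of
  the exponents are recorded.\<close>

definition locally :: "('a \<Rightarrow> 'a \<Rightarrow> 'a \<Rightarrow> bool) \<Rightarrow> (nat \<Rightarrow> 'a) \<Rightarrow> bool" where
  "locally \<Phi> s \<longleftrightarrow> (\<forall>p. \<Phi> (s 0) (s p) (s (Suc p)))"

lemma unfold_word_nth: "p < length u \<Longrightarrow> unfold_word u p = u ! p"
  unfolding unfold_word_def by (subst min_absorb1) auto

lemma unfold_word_beyond: "u \<noteq> [] \<Longrightarrow> length u \<le> Suc p \<Longrightarrow> unfold_word u p = last u"
  unfolding unfold_word_def by (subst min_absorb2) (auto simp: last_conv_nth)

text \<open>This form depends only on the part read so far, also beyond the end of the word, and so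
  suits an automaton that reads a padded track.\<close>

lemma unfold_word_eq_last: "u \<noteq> [] \<Longrightarrow> unfold_word u p = last (take (Suc p) u)"
  by (cases "p < length u") (auto simp: unfold_word_nth unfold_word_beyond take_Suc_conv_app_nth)

text \<open>From position \<open>N\<close> on all instances coincide with the one at
  \<open>N\<close>, so finitely many checks remain.\<close>

lemma locally_eventually_constant:
  assumes "\<And>p. p \<ge> N \<Longrightarrow> s p = s N"
  shows "locally \<Phi> s \<longleftrightarrow> (\<forall>p<N. \<Phi> (s 0) (s p) (s (Suc p))) \<and> \<Phi> (s 0) (s N) (s N)"
  unfolding locally_def
proof (intro iffI conjI allI impI)
  assume all: "\<forall>p. \<Phi> (s 0) (s p) (s (Suc p))"
  then show "\<Phi> (s 0) (s N) (s N)"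
    using assms[of "Suc N"] by (metis le_add2 plus_1_eq_Suc)
next
  fix p assume "(\<forall>p<N. \<Phi> (s 0) (s p) (s (Suc p))) \<and> \<Phi> (s 0) (s N) (s N)"
  then show "\<Phi> (s 0) (s p) (s (Suc p))"
    using assms[of p] assms[of "Suc p"] by (cases "p < N") auto
qed blast

text \<open>
  A word stands for the sequence that repeats its last letter forever; it is the shortest such word
  if its last two letters differ.
\<close>
definition reduced_words :: "'a set \<Rightarrow> ('a \<Rightarrow> bool) \<Rightarrow> ('a \<Rightarrow> 'a \<Rightarrow> 'a \<Rightarrow> bool) \<Rightarrow> 'a list set" where
  "reduced_words \<Sigma> B \<Psi> = {u \<in> lists \<Sigma>. u \<noteq> [] \<and> (butlast u = [] \<or> last (butlast u) \<noteq> last u) \<and>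
     B (last u) \<and> locally \<Psi> (unfold_word u)}"

text \<open>It suffices to remember whether the word is empty, its first and last letter, whether
  its last two letters differ, and whether all consecutive pairs so far were admissible.\<close>

lemma regular_reduced_words:
  assumes "finite \<Sigma>"
  shows "regular \<Sigma> (reduced_words \<Sigma> B \<Psi>)"
proof -
  define ok where "ok u \<longleftrightarrow> (\<forall>p. Suc p < length u \<longrightarrow> \<Psi> (hd u) (u ! p) (u ! Suc p))" for u
  define nonconst where "nonconst u \<longleftrightarrow> butlast u = [] \<or> last (butlast u) \<noteq> last u" for u :: "'a list"
  define h where "h u = (u = [], hd u, last u, nonconst u, ok u)" for u
  have ok: "ok (u @ [x]) \<longleftrightarrow> ok u \<and> (u \<noteq> [] \<longrightarrow> \<Psi> (hd u) (last u) x)" for u x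
  proof (cases "u = []")
    case False
    then have len: "length u > 0" and hd: "hd (u @ [x]) = hd u"
      by auto
    have Suc_less: "Suc p < length (u @ [x]) \<longleftrightarrow> Suc p < length u \<or> p = length u - 1" for p
      using len by auto
    have "ok (u @ [x]) \<longleftrightarrow> (\<forall>p. Suc p < length u \<or> p = length u - 1 \<longrightarrow>
        \<Psi> (hd u) ((u @ [x]) ! p) ((u @ [x]) ! Suc p))"
      unfolding ok_def hd Suc_less ..
    also have "\<dots> \<longleftrightarrow> ok u \<and> \<Psi> (hd u) (last u) x"
      using len unfolding ok_def last_conv_nth[OF \<open>u \<noteq> []\<close>] imp_disjL all_conj_distrib
      by (simp add: nth_append cong: imp_cong)
    finally show ?thesis using False by simp
  qed (simp add: ok_def)
  \<comment> \<open>The infinite repetition adds just the pair of the last letter with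
    itself.\<close>
  have loc: "locally \<Psi> (unfold_word u) \<longleftrightarrow> ok u \<and> \<Psi> (hd u) (last u) (last u)" if "u \<noteq> []" for u
  proof -
    have "locally \<Psi> (unfold_word u) \<longleftrightarrow> (\<forall>p<length u - 1. \<Psi> (unfold_word u 0) (unfold_word u p) (unfold_word u (Suc p)))
        \<and> \<Psi> (unfold_word u 0) (unfold_word u (length u - 1)) (unfold_word u (length u - 1))"
      using that by (intro locally_eventually_constant) (auto simp: unfold_word_def)
    also have "\<dots> \<longleftrightarrow> ok u \<and> \<Psi> (hd u) (last u) (last u)"
      using that by (auto simp: ok_def unfold_word_nth hd_conv_nth last_conv_nth)
    finally show ?thesis .
  qed
  \<comment> \<open>\<open>hd []\<close> and \<open>last []\<close> are the unspecified values
    contributed by the empty word.\<close>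
  have "h ` lists \<Sigma> \<subseteq> UNIV \<times> insert (hd []) \<Sigma> \<times> insert (last []) \<Sigma> \<times> UNIV \<times> UNIV"
  proof (rule image_subsetI)
    fix u assume "u \<in> lists \<Sigma>"
    then show "h u \<in> UNIV \<times> insert (hd []) \<Sigma> \<times> insert (last []) \<Sigma> \<times> UNIV \<times> UNIV"
      by (cases "u = []") (auto simp: h_def)
  qed
  then have "finite (h ` lists \<Sigma>)"
    by (rule finite_subset) (use assms in simp)
  then show ?thesis
  proof (rule regularI_congruence[OF assms])
    show "h (v @ [x]) = h (w @ [x])" if "h v = h w" for v w x
    proof -
      have "nonconst (u @ [x]) \<longleftrightarrow> u = [] \<or> last u \<noteq> x" for u
        by (simp add: nonconst_def)
      then show ?thesis
        using that unfolding h_def prod.inject ok by (simp add: hd_append)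
    qed
    show "w \<in> reduced_words \<Sigma> B \<Psi>" if "v \<in> reduced_words \<Sigma> B \<Psi>" "w \<in> lists \<Sigma>" "h v = h w" for v w
    proof -
      have "u \<in> reduced_words \<Sigma> B \<Psi> \<longleftrightarrow> u \<in> lists \<Sigma> \<and> u \<noteq> [] \<and> nonconst u \<and> B (last u) \<and>
          ok u \<and> \<Psi> (hd u) (last u) (last u)" for u
        using loc[of u] by (auto simp: reduced_words_def nonconst_def)
      then show ?thesis
        using that unfolding h_def prod.inject by simp
    qed
  qed (auto simp: reduced_words_def)
qed

text \<open>If one of two words with the same unfolding were longer, its last two letters would both
  lie in the constant tail of the shorter one and agree.\<close>

lemma inj_on_unfold_word: "inj_on unfold_word (reduced_words \<Sigma> B \<Psi>)"
proof -
  have *: "length v \<le> length u" if u: "u \<noteq> []" and v: "butlast v = [] \<or> last (butlast v) \<noteq> last v"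
    and eq: "unfold_word u = unfold_word v" for u v :: "'a list"
  proof (rule ccontr)
    assume "\<not> length v \<le> length u"
    then have l: "length u < length v" by simp
    then have "length v \<ge> 2"
      using u by (cases u) auto
    have "last v = last u"
      using fun_cong[OF eq, of "length v - 1"] l u
      by (subst (asm) (1 2) unfold_word_beyond) auto
    moreover have "unfold_word v (length v - 2) = last u"
      unfolding eq[symmetric] using l u by (intro unfold_word_beyond) auto
    moreover have b: "butlast v \<noteq> []"
      using \<open>length v \<ge> 2\<close> by (cases v rule: rev_cases) auto
    then have "unfold_word v (length v - 2) = last (butlast v)"
      using \<open>length v \<ge> 2\<close> by (auto simp: unfold_word_nth last_conv_nth nth_butlast numeral_2_eq_2)
    ultimately show False
      using v b by auto
  qed
  show ?thesis
  proof (rule inj_onI)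
    fix u v assume uv: "u \<in> reduced_words \<Sigma> B \<Psi>" "v \<in> reduced_words \<Sigma> B \<Psi>"
      and eq: "unfold_word u = unfold_word v"
    have "length u = length v"
      using *[of u v] *[of v u] uv eq by (auto simp: reduced_words_def)
    then show "u = v"
      using eq by (metis nth_equalityI unfold_word_nth)
  qed
qed

lemma image_unfold_word:
  "unfold_word ` reduced_words \<Sigma> B \<Psi> =
     {s. range s \<subseteq> \<Sigma> \<and> locally \<Psi> s \<and> (\<exists>x N. B x \<and> (\<forall>p\<ge>N. s p = x))}" (is "_ = ?S")
proof (intro equalityI subsetI)
  fix s assume "s \<in> unfold_word ` reduced_words \<Sigma> B \<Psi>"
  then obtain u where u: "s = unfold_word u" "u \<in> lists \<Sigma>" "u \<noteq> []" "B (last u)" "locally \<Psi> s"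
    by (auto simp: reduced_words_def)
  have "min p (length u - 1) < length u" for p
    using u(3) by (intro min.strict_coboundedI2) (cases u, auto)
  then have "range s \<subseteq> \<Sigma>"
    using u(2) by (force simp: u(1) unfold_word_def in_lists_conv_set)
  moreover have "\<forall>p\<ge>length u. s p = last u"
    using u(1,3) by (auto simp: unfold_word_beyond)
  ultimately show "s \<in> ?S"
    using u by blast
next
  fix s assume "s \<in> ?S"
  then obtain x N where s: "range s \<subseteq> \<Sigma>" "locally \<Psi> s" "B x" "\<forall>p\<ge>N. s p = x"
    by blast
  define n where "n = (LEAST N. \<forall>p\<ge>N. s p = x)"
  have n: "s p = x" if "p \<ge> n" for p
    using LeastI[of "\<lambda>N. \<forall>p\<ge>N. s p = x", OF s(4)] that unfolding n_def by blast
  \<comment> \<open>By minimality of \<open>n\<close> the letter before the constant tail differs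
    from \<open>x\<close>; this makes the word \<open>u\<close> below reduced.\<close>
  have prev: "s m \<noteq> x" if "n = Suc m" for m
  proof
    assume "s m = x"
    then have "\<forall>p\<ge>m. s p = x"
      using n that by (metis le_antisym not_less_eq_eq)
    then have "n \<le> m"
      unfolding n_def by (rule Least_le)
    then show False using that by simp
  qed
  define u where "u = map s [0..<n] @ [x]"
  have us: "unfold_word u = s"
    using n by (auto simp: u_def unfold_word_def min_def nth_append fun_eq_iff)
  have "last (butlast u) \<noteq> last u" if "butlast u \<noteq> []"
    using that prev by (cases n) (simp_all add: u_def butlast_append)
  moreover have "u \<in> lists \<Sigma>"
    using n[of n] s(1) by (auto simp: u_def in_lists_conv_set)
  ultimately have "u \<in> reduced_words \<Sigma> B \<Psi>"
    using s(2,3) us by (auto simp: reduced_words_def u_def)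
  then show "s \<in> unfold_word ` reduced_words \<Sigma> B \<Psi>"
    using us by blast
qed

section \<open>Convolutions of pairs\<close>

text \<open>This and the next two notions make sense for every list of columns, so that an automaton
  can follow them along its input and test whether the input is a convolution.\<close>

definition track :: "nat \<Rightarrow> 'a option list list \<Rightarrow> 'a option list" where
  "track t c = map (\<lambda>x. x ! t) c"

definition entries :: "nat \<Rightarrow> 'a option list list \<Rightarrow> 'a list" where
  "entries t c = map the (takeWhile (\<lambda>y. y \<noteq> None) (track t c))"

definition padded :: "nat \<Rightarrow> 'a option list list \<Rightarrow> bool" where
  "padded t c \<longleftrightarrow> set (dropWhile (\<lambda>y. y \<noteq> None) (track t c)) \<subseteq> {None}"

lemma track_snoc: "track t (c @ [x]) = track t c @ [x ! t]"
  by (simp add: track_def)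

lemma entries_snoc:
  "entries t (c @ [x]) =
     (if None \<in> set (track t c) \<or> x ! t = None then entries t c else entries t c @ [the (x ! t)])"
proof (cases "None \<in> set (track t c)")
  case True
  then show ?thesis
    by (simp add: entries_def track_snoc takeWhile_append1 del: not_None_eq)
next
  case False
  then have "\<And>y. y \<in> set (track t c) \<Longrightarrow> y \<noteq> None"
    by metis
  then have "takeWhile (\<lambda>y. y \<noteq> None) (track t c @ zs) = track t c @ takeWhile (\<lambda>y. y \<noteq> None) zs" for zs
    by (rule takeWhile_append2)
  note app = this
  show ?thesis
    using False unfolding entries_def track_snoc app app[of "[]", unfolded append_Nil2] by simp
qed

lemma padded_snoc: "padded t (c @ [x]) \<longleftrightarrow> padded t c \<and> (None \<in> set (track t c) \<longrightarrow> x ! t = None)"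
proof (cases "None \<in> set (track t c)")
  case True
  then show ?thesis
    by (simp add: padded_def track_snoc dropWhile_append1 conj_commute del: not_None_eq)
next
  case False
  then have "\<And>y. y \<in> set (track t c) \<Longrightarrow> y \<noteq> None"
    by metis
  then have "dropWhile (\<lambda>y. y \<noteq> None) (track t c @ zs) = dropWhile (\<lambda>y. y \<noteq> None) zs" for zs
    by (rule dropWhile_append2)
  note app = this
  show ?thesis
    using False unfolding padded_def track_snoc app app[of "[]", unfolded append_Nil2] by simp
qed

lemma track_padded:
  assumes "padded t c"
  shows "track t c = map Some (entries t c) @ replicate (length c - length (entries t c)) None"
proof -
  let ?P = "\<lambda>y. y \<noteq> (None :: 'a option)"
  have "length (track t c) = length (takeWhile ?P (track t c)) + length (dropWhile ?P (track t c))"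
    by (metis length_append takeWhile_dropWhile_id)
  then have "length (dropWhile ?P (track t c)) = length c - length (entries t c)"
    by (simp add: entries_def track_def del: not_None_eq)
  then have "dropWhile ?P (track t c) = replicate (length c - length (entries t c)) None"
    using assms by (intro replicate_eqI) (auto simp: padded_def)
  moreover have "takeWhile ?P (track t c) = map Some (entries t c)"
    unfolding entries_def map_map by (rule map_idI[symmetric]) (auto dest: set_takeWhileD)
  ultimately show ?thesis
    by (metis takeWhile_dropWhile_id)
qed

text \<open>The splitting of a track into letters and padding is unique, so any such splitting
  yields the entries.\<close>

lemma track_eq_padded:
  assumes "track t c = map Some u @ replicate m None"
  shows "entries t c = u" "padded t c"
proof -
  have "takeWhile (\<lambda>y. y \<noteq> None) (map Some u @ replicate m None) = map Some u"
    by (subst takeWhile_append2) (auto simp: takeWhile_replicate)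
  then show "entries t c = u"
    unfolding entries_def assms by simp
  have "dropWhile (\<lambda>y. y \<noteq> None) (map Some u @ replicate m None) = replicate m None"
    by (subst dropWhile_append2) (auto simp: dropWhile_replicate)
  then show "padded t c"
    unfolding padded_def assms by auto
qed

lemma convolution_pair:
  "convolution [u, v] =
     map (\<lambda>k. [if k < length u then Some (u ! k) else None, if k < length v then Some (v ! k) else None])
       [0..<max (length u) (length v)]"
  by (simp add: convolution_def)

text \<open>Convolutions are recognized from their columns alone: padding occurs only at the end of
  a track, and not in both tracks, since otherwise the length would exceed the maximum.\<close>

lemma convolution_pair_iff:
  "c = convolution [u, v] \<longleftrightarrow>
     (\<forall>x\<in>set c. length x = 2) \<and> padded 0 c \<and> padded 1 c \<and> entries 0 c = u \<and> entries 1 c = v \<and>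
     \<not> (None \<in> set (track 0 c) \<and> None \<in> set (track 1 c))" (is "?l \<longleftrightarrow> ?r")
proof
  assume c: ?l
  have *: "map (\<lambda>k. if k < length w then Some (w ! k) else None) [0..<n] = map Some w @ replicate (n - length w) None"
    if "length w \<le> n" for w :: "'a list" and n
    using that by (intro nth_equalityI) (auto simp: nth_append)
  have t: "track 0 c = map Some u @ replicate (max (length u) (length v) - length u) None"
      "track 1 c = map Some v @ replicate (max (length u) (length v) - length v) None"
    using *[of u "max (length u) (length v)"] *[of v "max (length u) (length v)"]
    by (simp_all add: c convolution_pair track_def comp_def)
  show ?r
    using track_eq_padded[OF t(1)] track_eq_padded[OF t(2)]
    by (auto simp: c convolution_pair track_def max_def split: if_splits)
next
  assume r: ?r
  let ?m = "length c - length u" and ?n = "length c - length v"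
  have t: "track 0 c = map Some u @ replicate ?m None" "track 1 c = map Some v @ replicate ?n None"
    using r track_padded[of 0 c] track_padded[of 1 c] by auto
  from t[THEN arg_cong[where f = length]] have le: "length u \<le> length c" "length v \<le> length c"
    by (simp_all add: track_def)
  \<comment> \<open>One track without padding forces the length to be the maximum.\<close>
  have "?m = 0 \<or> ?n = 0"
    using r unfolding t by auto
  then have len: "length c = max (length u) (length v)"
    using le by auto
  show ?l
  proof (rule nth_equalityI)
    fix k assume k: "k < length c"
    have "c ! k ! 0 = track 0 c ! k" "c ! k ! 1 = track 1 c ! k"
      using k by (simp_all add: track_def)
    then have "c ! k ! 0 = (if k < length u then Some (u ! k) else None)"
        "c ! k ! 1 = (if k < length v then Some (v ! k) else None)"
      using k unfolding t by (auto simp: nth_append)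
    moreover have "length (c ! k) = 2"
      using r k by auto
    ultimately show "c ! k = convolution [u, v] ! k"
      using k len by (auto simp: convolution_pair intro!: nth_equalityI simp: less_2_cases_iff)
  qed (simp add: convolution_pair len)
qed

lemma entries_take: "padded t c \<Longrightarrow> entries t (take n c) = take n (entries t c)"
proof -
  assume "padded t c"
  have "track t (take n c) = take n (map Some (entries t c) @ replicate (length c - length (entries t c)) None)"
    unfolding track_padded[OF \<open>padded t c\<close>, symmetric] by (simp add: track_def take_map)
  also have "\<dots> = map Some (take n (entries t c)) @ replicate (min (length c - length (entries t c)) (n - length (entries t c))) None"
    by (simp add: take_map min.commute)
  finally show ?thesis
    by (rule track_eq_padded)
qed

text \<open>Locality becomes a condition on consecutive prefixes of the convolution. It is checked
  together with the shape of a convolution and, through the congruence \<open>H\<close>, membership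
  of both tracks in \<open>R\<close>.\<close>

lemma FA_recognizable_locally:
  assumes R: "regular \<Sigma> R" and ne: "[] \<notin> R"
  shows "FA_recognizable \<Sigma> 2
    {[u, v] | u v. u \<in> R \<and> v \<in> R \<and> locally \<Phi> (\<lambda>p. (unfold_word u p, unfold_word v p))}"
    (is "FA_recognizable _ _ ?S")
proof -
  obtain H :: "'a list \<Rightarrow> nat set" where H: "finite (range H)"
      "\<And>v w x. H v = H w \<Longrightarrow> H (v @ [x]) = H (w @ [x])"
      "\<And>v w. v \<in> R \<Longrightarrow> w \<in> lists \<Sigma> \<Longrightarrow> H v = H w \<Longrightarrow> w \<in> R"
    using regularE_congruence[OF R] by blast
  have fin: "finite \<Sigma>" and R_sub: "R \<subseteq> lists \<Sigma>"
    using R by (auto simp: regular_def)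
  let ?A = "padded_alphabet \<Sigma> 2"
  \<comment> \<open>The current letters of both unfolded words: a track that has ended keeps its
    last letter.\<close>
  define G where "G c = (last (entries 0 c), last (entries 1 c))" for c :: "'a option list list"
  define ok where "ok c \<longleftrightarrow>
    (\<forall>p. Suc p < length c \<longrightarrow> \<Phi> (G (take 1 c)) (G (take (Suc p) c)) (G (take (Suc (Suc p)) c)))" for c
  define T where "T t c = (H (entries t c), None \<in> set (track t c), padded t c)" for t c
  define h where "h c = (T 0 c, T 1 c, c = [], G (take 1 c), G c, ok c)" for c
  have entries_in: "entries t c \<in> lists \<Sigma>" if "c \<in> lists ?A" "t < 2" for t c
    using that(1)
  proof (induction c rule: rev_induct)
    case Nil
    then show ?case by (simp add: entries_def track_def)
  next
    case (snoc x c)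
    then have "x ! t \<in> set x" "set x \<subseteq> insert None (Some ` \<Sigma>)"
      using that(2) by (auto simp: padded_alphabet_def intro!: nth_mem)
    then have "x ! t \<in> insert None (Some ` \<Sigma>)"
      by blast
    then show ?case
      using snoc by (auto simp: entries_snoc)
  qed
  have G_snoc: "G (c @ [x]) = (if None \<in> set (track 0 c) \<or> x ! 0 = None then fst (G c) else the (x ! 0),
      if None \<in> set (track 1 c) \<or> x ! 1 = None then snd (G c) else the (x ! 1))" for c x
    by (simp add: G_def entries_snoc)
  have ok_snoc: "ok (c @ [x]) \<longleftrightarrow> ok c \<and> (c \<noteq> [] \<longrightarrow> \<Phi> (G (take 1 c)) (G c) (G (c @ [x])))" for c x
  proof (cases "c = []")
    case False
    then have len: "length c > 0" and take1: "take 1 (c @ [x]) = take 1 c"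
      by (cases c; simp)+
    have Suc_less: "Suc p < length (c @ [x]) \<longleftrightarrow> Suc p < length c \<or> p = length c - 1" for p
      using len by auto
    have "ok (c @ [x]) \<longleftrightarrow> (\<forall>p. Suc p < length c \<or> p = length c - 1 \<longrightarrow>
        \<Phi> (G (take 1 c)) (G (take (Suc p) (c @ [x]))) (G (take (Suc (Suc p)) (c @ [x]))))"
      unfolding ok_def take1 Suc_less ..
    also have "\<dots> \<longleftrightarrow> ok c \<and> \<Phi> (G (take 1 c)) (G c) (G (c @ [x]))"
      using len unfolding ok_def imp_disjL all_conj_distrib by (simp cong: imp_cong)
    finally show ?thesis using False by simp
  qed (simp add: ok_def)
  \<comment> \<open>Over the padded alphabet, every condition on the right is determined by the
    value of \<open>h\<close> below.\<close>
  have conv: "convolution ` ?S = {c \<in> lists ?A. padded 0 c \<and> padded 1 c \<and>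
      entries 0 c \<in> R \<and> entries 1 c \<in> R \<and> \<not> (None \<in> set (track 0 c) \<and> None \<in> set (track 1 c)) \<and>
      ok c \<and> \<Phi> (G (take 1 c)) (G c) (G c)}" (is "_ = ?L")
  proof -
    have loc: "locally \<Phi> (\<lambda>p. (unfold_word u p, unfold_word v p)) \<longleftrightarrow> ok c \<and> \<Phi> (G (take 1 c)) (G c) (G c)"
      if c: "c = convolution [u, v]" and uv: "u \<noteq> []" "v \<noteq> []" for c u v
    proof -
      let ?s = "\<lambda>p. (unfold_word u p, unfold_word v p)"
      have s: "?s p = G (take (Suc p) c)" for p
        using c[unfolded convolution_pair_iff] uv by (auto simp: G_def entries_take unfold_word_eq_last)
      have len: "length c = max (length u) (length v)"
        by (simp add: c convolution_pair)
      then have "length c > 0"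
        using uv by (simp add: less_max_iff_disj)
      have "locally \<Phi> ?s \<longleftrightarrow> (\<forall>p<length c - 1. \<Phi> (?s 0) (?s p) (?s (Suc p))) \<and>
          \<Phi> (?s 0) (?s (length c - 1)) (?s (length c - 1))"
        using uv len by (intro locally_eventually_constant) (simp add: unfold_word_beyond)
      also have "\<dots> \<longleftrightarrow> ok c \<and> \<Phi> (G (take 1 c)) (G c) (G c)"
        unfolding s using \<open>length c > 0\<close> by (simp add: ok_def less_diff_conv)
      finally show ?thesis .
    qed
    have in_lists: "convolution [u, v] \<in> lists ?A" if "u \<in> R" "v \<in> R" for u v
    proof -
      have "u ! k \<in> \<Sigma>" if "k < length u" for k
        using that \<open>u \<in> R\<close> R_sub by (auto simp: in_lists_conv_set)
      moreover have "v ! k \<in> \<Sigma>" if "k < length v" for k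
        using that \<open>v \<in> R\<close> R_sub by (auto simp: in_lists_conv_set)
      ultimately show ?thesis
        by (auto simp: convolution_pair padded_alphabet_def in_lists_conv_set)
    qed
    show ?thesis
    proof (intro equalityI subsetI)
      fix c assume "c \<in> convolution ` ?S"
      then obtain u v where "c = convolution [u, v]" "u \<in> R" "v \<in> R"
          "locally \<Phi> (\<lambda>p. (unfold_word u p, unfold_word v p))"
        by blast
      moreover from this have "u \<noteq> []" "v \<noteq> []"
        using ne by auto
      ultimately have "ok c \<and> \<Phi> (G (take 1 c)) (G c) (G c)" "c \<in> lists ?A"
        using loc in_lists by blast+
      then show "c \<in> ?L"
        using \<open>c = convolution [u, v]\<close>[unfolded convolution_pair_iff] \<open>u \<in> R\<close> \<open>v \<in> R\<close> by simp
    next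
      fix c assume c: "c \<in> ?L"
      then have "\<forall>x\<in>set c. length x = 2"
        by (auto simp: padded_alphabet_def)
      then have "c = convolution [entries 0 c, entries 1 c]"
        using c by (simp add: convolution_pair_iff)
      moreover have "entries 0 c \<noteq> []" "entries 1 c \<noteq> []"
        using c ne by auto
      ultimately have "locally \<Phi> (\<lambda>p. (unfold_word (entries 0 c) p, unfold_word (entries 1 c) p))"
        using c loc by blast
      then show "c \<in> convolution ` ?S"
        using c \<open>c = convolution [entries 0 c, entries 1 c]\<close> by blast
    qed
  qed
  have fin_A: "finite ?A"
  proof -
    have "?A = {xs. set xs \<subseteq> insert None (Some ` \<Sigma>) \<and> length xs = 2}"
      by (auto simp: padded_alphabet_def)
    then show ?thesis
      using fin by (simp add: finite_lists_length_eq)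
  qed
  have "finite (h ` lists ?A)"
  proof (rule finite_subset)
    \<comment> \<open>\<open>last []\<close> arises while a track has no entries.\<close>
    let ?B = "insert (last []) \<Sigma>"
    have last: "last w \<in> ?B" if "w \<in> lists \<Sigma>" for w
      using that by (cases "w = []") auto
    have G_in: "G c \<in> ?B \<times> ?B" if "c \<in> lists ?A" for c
      unfolding G_def using last[OF entries_in[OF that]] by (intro SigmaI) simp_all
    show "h ` lists ?A \<subseteq> (range H \<times> UNIV \<times> UNIV) \<times> (range H \<times> UNIV \<times> UNIV) \<times> UNIV \<times>
        (?B \<times> ?B) \<times> (?B \<times> ?B) \<times> UNIV"
    proof (rule image_subsetI)
      fix c assume "c \<in> lists ?A"
      moreover from this have "take 1 c \<in> lists ?A"
        by (cases c) auto
      ultimately show "h c \<in> (range H \<times> UNIV \<times> UNIV) \<times> (range H \<times> UNIV \<times> UNIV) \<times> UNIV \<times>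
          (?B \<times> ?B) \<times> (?B \<times> ?B) \<times> UNIV"
        using G_in by (simp add: h_def T_def)
    qed
  qed (use fin H(1) in simp)
  then have "regular ?A ?L"
  proof (rule regularI_congruence[OF fin_A])
    show "h (v @ [x]) = h (w @ [x])" if "h v = h w" for v w x
    proof -
      have "T t (v @ [x]) = T t (w @ [x])" if "T t v = T t w" for t
        using that H(2)[of "entries t v" "entries t w" "the (x ! t)"]
        unfolding T_def track_snoc entries_snoc padded_snoc prod.inject by simp
      moreover have "take 1 (c @ [x]) = (if c = [] then [x] else take 1 c)" for c
        by (cases c) auto
      moreover have "G (v @ [x]) = G (w @ [x])"
        using that unfolding G_snoc h_def T_def prod.inject by simp
      ultimately show ?thesis
        using that unfolding h_def ok_snoc prod.inject by simp
    qed
    show "w \<in> ?L" if "v \<in> ?L" "w \<in> lists ?A" "h v = h w" for v w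
    proof -
      have "entries t w \<in> R" if "entries t v \<in> R" "T t v = T t w" "t < 2" for t
        using H(3)[OF that(1) entries_in[OF \<open>w \<in> lists ?A\<close> that(3)]] that(2) by (simp add: T_def)
      from this[of 0] this[of 1] have "entries 0 w \<in> R" "entries 1 w \<in> R"
        using that by (simp_all add: h_def)
      then show ?thesis
        using that unfolding h_def T_def prod.inject mem_Collect_eq by metis
    qed
  qed auto
  then show ?thesis
    unfolding FA_recognizable_def conv using R_sub by auto
qed

section \<open>Presented groups\<close>

definition bs_relators :: "nat \<Rightarrow> (bs_gen letter list \<times> bs_gen letter list) set" where
  "bs_relators n = {([GInv gen_a, Gen gen_b, Gen gen_a], replicate n (Gen gen_b))}"

lemma Baumslag_Solitar_1_eq: "Baumslag_Solitar 1 n = presented_group (bs_relators n)"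
  by (simp add: Baumslag_Solitar_def bs_relators_def)

definition word_class :: "('x letter list \<times> 'x letter list) set \<Rightarrow> 'x letter list \<Rightarrow> 'x letter list set" where
  "word_class S u = word_cong S `` {u}"

lemma word_class_eq_iff: "word_class S u = word_class S v \<longleftrightarrow> (u, v) \<in> word_cong S"
  unfolding word_class_def using eq_equiv_class_iff[OF equiv_word_cong] by blast

lemma word_class_append: "word_class S (u @ v) = word_class S u \<otimes>\<^bsub>presented_group S\<^esub> word_class S v"
  by (simp add: word_class_def mult_presented_group)

lemma word_class_Nil: "word_class S [] = \<one>\<^bsub>presented_group S\<^esub>"
  by (simp add: word_class_def presented_group_def)

lemma carrier_presented_group: "carrier (presented_group S) = range (word_class S)"
  by (auto simp: word_class_def presented_group_def quotient_def)

lemma word_class_replicate: "word_class S (replicate m x) = word_class S [x] [^]\<^bsub>presented_group S\<^esub> m"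
proof (induction m)
  case (Suc m)
  have "word_class S (replicate (Suc m) x) = word_class S (replicate m x @ [x])"
    by (simp add: replicate_append_same)
  then show ?case
    using Suc by (simp add: word_class_append)
qed (simp add: word_class_Nil)

lemma word_class_GInv: "word_class S [GInv x] = inv\<^bsub>presented_group S\<^esub> word_class S [Gen x]"
proof -
  interpret group "presented_group S"
    by (rule group_presented_group)
  have "word_class S [GInv x] \<otimes>\<^bsub>presented_group S\<^esub> word_class S [Gen x] = \<one>\<^bsub>presented_group S\<^esub>"
    using word_cong.cancel[of "[]" "GInv x" "[]" S]
    by (simp add: word_class_eq_iff flip: word_class_append word_class_Nil)
  then show ?thesis
    by (intro inv_equality[symmetric]) (auto simp: carrier_presented_group)
qed

lemma generate_presented_group:
  "generate (presented_group S) (range (\<lambda>x. word_class S [Gen x])) = carrier (presented_group S)"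
    (is "generate ?G ?X = _")
proof -
  interpret group ?G
    by (rule group_presented_group)
  have "word_class S u \<in> generate ?G ?X" for u
  proof (induction u)
    case Nil
    then show ?case by (simp add: word_class_Nil generate.one)
  next
    case (Cons y u)
    have "word_class S [y] \<in> generate ?G ?X"
      by (cases y) (auto simp: word_class_GInv intro: generate.incl generate.inv)
    then show ?case
      using generate.eng[OF _ Cons] word_class_append[of S "[y]" u] by simp
  qed
  moreover have "generate ?G ?X \<subseteq> carrier ?G"
    by (rule generate_incl) (auto simp: carrier_presented_group)
  ultimately show ?thesis
    by (auto simp: carrier_presented_group)
qed

text \<open>Letters act from left to right, as they do under right multiplication.\<close>

fun act_word :: "('x letter \<Rightarrow> 'm \<Rightarrow> 'm) \<Rightarrow> 'x letter list \<Rightarrow> 'm \<Rightarrow> 'm" where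
  "act_word f [] m = m"
| "act_word f (x # u) m = act_word f u (f x m)"

lemma act_word_append: "act_word f (u @ v) m = act_word f v (act_word f u m)"
  by (induction u arbitrary: m) auto

text \<open>
  \<open>M\<close> is a set of normal forms, \<open>\<sigma> m\<close> the word of the normal form \<open>m\<close>. The action of words on \<open>M\<close>
  recovers \<open>m\<close> from the class of \<open>\<sigma> m\<close>.
\<close>
lemma bij_betw_presented_group:
  fixes f :: "'x letter \<Rightarrow> 'm \<Rightarrow> 'm"
  assumes closed: "\<And>x m. m \<in> M \<Longrightarrow> f x m \<in> M"
    and inverse: "\<And>x m. m \<in> M \<Longrightarrow> f (inv_letter x) (f x m) = m"
    and relators: "\<And>r s m. (r, s) \<in> S \<Longrightarrow> m \<in> M \<Longrightarrow> act_word f r m = act_word f s m"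
    and base: "z \<in> M" "\<sigma> z = []"
    and retract: "\<And>m. m \<in> M \<Longrightarrow> act_word f (\<sigma> m) z = m"
    and equivariant: "\<And>x m. m \<in> M \<Longrightarrow> word_class S (\<sigma> m @ [Gen x]) = word_class S (\<sigma> (f (Gen x) m))"
  shows "bij_betw (\<lambda>m. word_class S (\<sigma> m)) M (carrier (presented_group S))"
proof -
  have act_in: "act_word f u m \<in> M" if "m \<in> M" for u m
    using that by (induction u arbitrary: m) (auto simp: closed)
  \<comment> \<open>The action factors through the presented group: \<open>inverse\<close> handles
    cancellation and \<open>relators\<close> the defining relations.\<close>
  have act_cong: "act_word f u m = act_word f v m" if "(u, v) \<in> word_cong S" "m \<in> M" for u v m
    using that by (induction arbitrary: m rule: word_cong.induct)
      (simp_all add: act_word_append inverse act_in relators)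
  have equiv: "word_class S (\<sigma> m @ [y]) = word_class S (\<sigma> (f y m))" if "m \<in> M" for y m
  proof (cases y)
    case (Gen x)
    then show ?thesis using equivariant that by simp
  next
    case (GInv x)
    \<comment> \<open>Since \<open>Gen x\<close> leads from \<open>?m\<close> back to
      \<open>m\<close>, the inverse letter cancels it in the word of \<open>m\<close>.\<close>
    let ?m = "f y m"
    have m: "f (Gen x) ?m = m" "?m \<in> M"
      using inverse[OF that, of y] closed[OF that] by (auto simp: GInv)
    have "word_class S (\<sigma> m @ [y]) = word_class S (\<sigma> ?m @ [Gen x, GInv x])"
      using equivariant[OF m(2), of x] m(1) GInv
        word_class_append[of S "\<sigma> m" "[y]"] word_class_append[of S "\<sigma> ?m @ [Gen x]" "[y]"] by simp
    also have "\<dots> = word_class S (\<sigma> ?m)"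
      using word_cong.cancel[of "\<sigma> ?m" "Gen x" "[]" S] by (simp add: word_class_eq_iff)
    finally show ?thesis .
  qed
  \<comment> \<open>Every word is congruent to the word of the normal form that it reaches from
    \<open>z\<close>; this gives surjectivity.\<close>
  have "word_class S u = word_class S (\<sigma> (act_word f u z))" for u
  proof (induction u rule: rev_induct)
    case Nil
    then show ?case using base by simp
  next
    case (snoc y u)
    have "word_class S (u @ [y]) = word_class S (\<sigma> (act_word f u z) @ [y])"
      using snoc by (simp add: word_class_append)
    then show ?case
      using equiv[OF act_in[OF base(1)]] by (simp add: act_word_append)
  qed
  then have "carrier (presented_group S) \<subseteq> (\<lambda>m. word_class S (\<sigma> m)) ` M"
    using act_in[OF base(1)] by (auto simp: carrier_presented_group)
  moreover have "inj_on (\<lambda>m. word_class S (\<sigma> m)) M"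
    by (rule inj_onI) (metis act_cong base(1) retract word_class_eq_iff)
  ultimately show ?thesis
    by (auto simp: bij_betw_def carrier_presented_group)
qed

section \<open>Normal forms in Baumslag-Solitar groups\<close>

definition bs_normal :: "nat \<Rightarrow> (nat \<times> int \<times> nat) set" where
  "bs_normal n = {(i, k, j). (i = 0 \<or> j = 0 \<or> \<not> int n dvd k) \<and> (n = 0 \<longrightarrow> k = 0)}"

text \<open>The exponent \<open>u\<close> with \<open>a^-j b = b^u a^-j\<close>. For
  \<open>n = 0\<close> the generator \<open>b\<close> is trivial, whereas \<open>0 ^ 0 = 1\<close>
  would give the wrong value at \<open>j = 0\<close>.\<close>

definition bs_unit :: "nat \<Rightarrow> nat \<Rightarrow> int" where
  "bs_unit n j = (if n = 0 then 0 else int n ^ j)"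

text \<open>The reducing case of \<open>GInv gen_a\<close> is \<open>a b^(nl) a^-1 = b^l\<close>.
  For \<open>n = 0\<close> it also applies, with \<open>k = 0\<close> and
  \<open>k div 0 = 0\<close>.\<close>

fun bs_act :: "nat \<Rightarrow> bs_gen letter \<Rightarrow> nat \<times> int \<times> nat \<Rightarrow> nat \<times> int \<times> nat" where
  "bs_act n (Gen gen_a) (i, k, j) = (if j = 0 then (Suc i, int n * k, 0) else (i, k, j - 1))"
| "bs_act n (GInv gen_a) (i, k, j) =
     (if j = 0 \<and> i > 0 \<and> int n dvd k then (i - 1, k div int n, 0) else (i, k, Suc j))"
| "bs_act n (Gen gen_b) (i, k, j) = (i, k + bs_unit n j, j)"
| "bs_act n (GInv gen_b) (i, k, j) = (i, k - bs_unit n j, j)"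

definition bs_power :: "int \<Rightarrow> bs_gen letter list" where
  "bs_power k = (if k \<ge> 0 then replicate (nat k) (Gen gen_b) else replicate (nat (- k)) (GInv gen_b))"

fun bs_word :: "nat \<times> int \<times> nat \<Rightarrow> bs_gen letter list" where
  "bs_word (i, k, j) = replicate i (Gen gen_a) @ bs_power k @ replicate j (GInv gen_a)"

text \<open>Adding or subtracting \<open>n^j\<close> with \<open>j > 0\<close> does not affect
  divisibility by \<open>n\<close>; for \<open>j = 0\<close> no divisibility condition is
  imposed.\<close>

lemma bs_act_in: "m \<in> bs_normal n \<Longrightarrow> bs_act n x m \<in> bs_normal n"
  by (cases "(n, x, m)" rule: bs_act.cases)
    (auto simp: bs_normal_def bs_unit_def dvd_add_left_iff dvd_diff_left_iff)

text \<open>When \<open>a\<close> lowers \<open>j\<close> to \<open>0\<close>, normality prevents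
  the following inverse letter from taking the reducing branch.\<close>

lemma bs_act_inverse: "m \<in> bs_normal n \<Longrightarrow> bs_act n (inv_letter x) (bs_act n x m) = m"
  by (cases "(n, x, m)" rule: bs_act.cases) (auto simp: bs_normal_def bs_unit_def)

lemma act_replicate_b: "act_word (bs_act n) (replicate p (Gen gen_b)) (i, k, j) = (i, k + int p * bs_unit n j, j)"
  by (induction p arbitrary: k) (auto simp: algebra_simps)

lemma act_replicate_b_inv: "act_word (bs_act n) (replicate p (GInv gen_b)) (i, k, j) = (i, k - int p * bs_unit n j, j)"
  by (induction p arbitrary: k) (auto simp: algebra_simps)

text \<open>The inverse of \<open>a\<close> either raises \<open>j\<close>, so that \<open>b\<close>
  adds \<open>n^(j+1)\<close>, or divides \<open>k\<close> by \<open>n\<close>, and then the final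
  \<open>a\<close> multiplies the added \<open>1\<close> by \<open>n\<close>. Both agree with adding
  \<open>bs_unit n j\<close> exactly \<open>n\<close> times.\<close>

lemma bs_act_relators:
  assumes "(r, s) \<in> bs_relators n" "m \<in> bs_normal n"
  shows "act_word (bs_act n) r m = act_word (bs_act n) s m"
proof -
  obtain i k j where m: "m = (i, k, j)" by (cases m)
  show ?thesis
    using assms by (auto simp: bs_relators_def m act_replicate_b bs_normal_def bs_unit_def algebra_simps)
qed

lemma act_bs_word:
  assumes "m \<in> bs_normal n"
  shows "act_word (bs_act n) (bs_word m) (0, 0, 0) = m"
proof -
  obtain i k j where m: "m = (i, k, j)" by (cases m)
  have a: "act_word (bs_act n) (replicate i (Gen gen_a)) (i', 0, 0) = (i + i', 0, 0)" for i'
    by (induction i arbitrary: i') auto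
  have b: "act_word (bs_act n) (bs_power k) (i, 0, 0) = (i, k, 0)"
    using assms by (auto simp: bs_power_def act_replicate_b act_replicate_b_inv bs_unit_def m bs_normal_def)
  \<comment> \<open>Only the first inverse letter could reduce, and normality excludes this; once
    \<open>j' > 0\<close> every further one just counts up.\<close>
  have c: "act_word (bs_act n) (replicate j (GInv gen_a)) (i, k, j') = (i, k, j' + j)"
    if "j = 0 \<or> j' > 0 \<or> i = 0 \<or> \<not> int n dvd k" for j'
    using that by (induction j arbitrary: j') auto
  show ?thesis
    using a[of 0] b c[of 0] assms by (auto simp: m act_word_append bs_normal_def)
qed

lemma word_class_bs_power:
  "word_class S (bs_power k) = word_class S [Gen gen_b] [^]\<^bsub>presented_group S\<^esub> k"
proof -
  interpret group "presented_group S"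
    by (rule group_presented_group)
  have b: "word_class S [Gen gen_b] \<in> carrier (presented_group S)"
    by (auto simp: carrier_presented_group)
  show ?thesis
  proof (cases "k < 0")
    case True
    then have "word_class S (bs_power k) = word_class S (replicate (nat (- k)) (GInv gen_b))"
      by (simp add: bs_power_def)
    also have "\<dots> = inv\<^bsub>presented_group S\<^esub> (word_class S [Gen gen_b] [^]\<^bsub>presented_group S\<^esub> nat (- k))"
      unfolding word_class_replicate word_class_GInv by (rule nat_pow_inv[OF b])
    finally show ?thesis
      unfolding int_pow_def2 using True by (simp only: if_True)
  next
    case False
    then have "word_class S (bs_power k) = word_class S (replicate (nat k) (Gen gen_b))"
      by (simp add: bs_power_def)
    then show ?thesis
      unfolding int_pow_def2 word_class_replicate using False by (simp only: if_False)
  qed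
qed

text \<open>Conjugation by \<open>a\<close> is an endomorphism that sends \<open>b\<close> to
  \<open>b^n\<close>. Hence \<open>a\<close> moves left past powers of \<open>b\<close>, and
  \<open>b\<close> moves left past powers of the inverse of \<open>a\<close>.\<close>

lemma bs_word_equivariant:
  assumes "m \<in> bs_normal n"
  shows "word_class (bs_relators n) (bs_word m @ [Gen x]) = word_class (bs_relators n) (bs_word (bs_act n (Gen x) m))"
proof -
  obtain i k j where m: "m = (i, k, j)" by (cases m)
  let ?S = "bs_relators n"
  define G where "G = presented_group ?S"
  interpret group G
    unfolding G_def by (rule group_presented_group)
  define a b where "a = word_class ?S [Gen gen_a]" and "b = word_class ?S [Gen gen_b]"
  have ab: "a \<in> carrier G" "b \<in> carrier G"
    by (auto simp: a_def b_def G_def carrier_presented_group)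
  have bs_word: "word_class ?S (bs_word (i, k, j)) = a [^]\<^bsub>G\<^esub> i \<otimes>\<^bsub>G\<^esub> (b [^]\<^bsub>G\<^esub> k \<otimes>\<^bsub>G\<^esub> inv\<^bsub>G\<^esub> a [^]\<^bsub>G\<^esub> j)" for i k j
    unfolding bs_word.simps word_class_append word_class_replicate word_class_bs_power word_class_GInv G_def a_def b_def ..
  have "word_class ?S [GInv gen_a, Gen gen_b, Gen gen_a] = word_class ?S (replicate n (Gen gen_b))"
    using word_cong.rel[of "[GInv gen_a, Gen gen_b, Gen gen_a]" "replicate n (Gen gen_b)" ?S "[]" "[]"]
    by (simp add: word_class_eq_iff) (simp add: bs_relators_def)
  then have rel: "inv\<^bsub>G\<^esub> a \<otimes>\<^bsub>G\<^esub> (b \<otimes>\<^bsub>G\<^esub> a) = b [^]\<^bsub>G\<^esub> n"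
    unfolding G_def a_def b_def word_class_GInv[symmetric] word_class_append[symmetric] word_class_replicate[symmetric]
    by simp
  define c where "c g = inv\<^bsub>G\<^esub> a \<otimes>\<^bsub>G\<^esub> (g \<otimes>\<^bsub>G\<^esub> a)" for g
  have cancel: "a \<otimes>\<^bsub>G\<^esub> (inv\<^bsub>G\<^esub> a \<otimes>\<^bsub>G\<^esub> g) = g" if "g \<in> carrier G" for g
    using ab that by (simp flip: m_assoc)
  have "c \<in> hom G G"
    using ab by (intro homI) (simp_all add: c_def m_assoc cancel)
  then interpret c: group_hom G G c
    by unfold_locales
  have conj_pow: "c (b [^]\<^bsub>G\<^esub> k) = b [^]\<^bsub>G\<^esub> (int n * k)" for k :: int
    using c.hom_int_pow[OF ab(2)] rel ab by (simp add: c_def int_pow_pow flip: int_pow_int)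
  have push: "b [^]\<^bsub>G\<^esub> k \<otimes>\<^bsub>G\<^esub> a = a \<otimes>\<^bsub>G\<^esub> b [^]\<^bsub>G\<^esub> (int n * k)" for k :: int
    unfolding conj_pow[symmetric] c_def using ab by (simp add: cancel)
  have "inv\<^bsub>G\<^esub> a \<otimes>\<^bsub>G\<^esub> b [^]\<^bsub>G\<^esub> k = b [^]\<^bsub>G\<^esub> (int n * k) \<otimes>\<^bsub>G\<^esub> inv\<^bsub>G\<^esub> a" for k :: int
    unfolding conj_pow[symmetric] c_def using ab by (simp add: m_assoc)
  note pull_once = this
  have pull: "inv\<^bsub>G\<^esub> a [^]\<^bsub>G\<^esub> j \<otimes>\<^bsub>G\<^esub> b [^]\<^bsub>G\<^esub> k = b [^]\<^bsub>G\<^esub> (int n ^ j * k) \<otimes>\<^bsub>G\<^esub> inv\<^bsub>G\<^esub> a [^]\<^bsub>G\<^esub> j"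
    for j :: nat and k :: int
  proof (induction j arbitrary: k)
    case (Suc j)
    have "inv\<^bsub>G\<^esub> a [^]\<^bsub>G\<^esub> Suc j \<otimes>\<^bsub>G\<^esub> b [^]\<^bsub>G\<^esub> k = inv\<^bsub>G\<^esub> a [^]\<^bsub>G\<^esub> j \<otimes>\<^bsub>G\<^esub> (inv\<^bsub>G\<^esub> a \<otimes>\<^bsub>G\<^esub> b [^]\<^bsub>G\<^esub> k)"
      using ab by (simp add: m_assoc)
    also have "\<dots> = inv\<^bsub>G\<^esub> a [^]\<^bsub>G\<^esub> j \<otimes>\<^bsub>G\<^esub> b [^]\<^bsub>G\<^esub> (int n * k) \<otimes>\<^bsub>G\<^esub> inv\<^bsub>G\<^esub> a"
      unfolding pull_once using ab by (simp add: m_assoc)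
    also have "\<dots> = b [^]\<^bsub>G\<^esub> (int n ^ Suc j * k) \<otimes>\<^bsub>G\<^esub> inv\<^bsub>G\<^esub> a [^]\<^bsub>G\<^esub> Suc j"
      unfolding Suc using ab by (simp add: m_assoc mult.assoc mult.left_commute)
    finally show ?case .
  qed (use ab in simp)
  show ?thesis
  proof (cases x)
    case gen_a
    have snoc: "word_class ?S (bs_word m @ [Gen x]) =
        a [^]\<^bsub>G\<^esub> i \<otimes>\<^bsub>G\<^esub> (b [^]\<^bsub>G\<^esub> k \<otimes>\<^bsub>G\<^esub> (inv\<^bsub>G\<^esub> a [^]\<^bsub>G\<^esub> j \<otimes>\<^bsub>G\<^esub> a))"
      unfolding word_class_append m bs_word gen_a a_def[symmetric] G_def[symmetric] using ab by (simp add: m_assoc)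
    show ?thesis
    proof (cases j)
      case 0
      then show ?thesis
        unfolding snoc using ab by (simp add: m gen_a bs_word push m_assoc del: bs_word.simps)
    next
      case (Suc j')
      then show ?thesis
        unfolding snoc using ab by (simp add: m gen_a bs_word m_assoc del: bs_word.simps)
    qed
  next
    case gen_b
    have "word_class ?S (bs_word m @ [Gen x]) =
        a [^]\<^bsub>G\<^esub> i \<otimes>\<^bsub>G\<^esub> (b [^]\<^bsub>G\<^esub> k \<otimes>\<^bsub>G\<^esub> (inv\<^bsub>G\<^esub> a [^]\<^bsub>G\<^esub> j \<otimes>\<^bsub>G\<^esub> b))"
      unfolding word_class_append m bs_word gen_b b_def[symmetric] G_def[symmetric] using ab by (simp add: m_assoc)
    also have "inv\<^bsub>G\<^esub> a [^]\<^bsub>G\<^esub> j \<otimes>\<^bsub>G\<^esub> b = b [^]\<^bsub>G\<^esub> bs_unit n j \<otimes>\<^bsub>G\<^esub> inv\<^bsub>G\<^esub> a [^]\<^bsub>G\<^esub> j"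
    proof (cases "n = 0")
      \<comment> \<open>For \<open>n = 0\<close> the relation becomes \<open>ba = a\<close>, so
        \<open>b\<close> is the identity.\<close>
      case True
      then have "b \<otimes>\<^bsub>G\<^esub> a = a"
        using push[of 1] ab by simp
      then have "b = \<one>\<^bsub>G\<^esub>"
        using ab by (metis r_cancel_one')
      then show ?thesis
        using True ab by (simp add: bs_unit_def)
    next
      case False
      then show ?thesis
        using pull[of j 1] ab by (simp add: bs_unit_def)
    qed
    also have "b [^]\<^bsub>G\<^esub> k \<otimes>\<^bsub>G\<^esub> (b [^]\<^bsub>G\<^esub> bs_unit n j \<otimes>\<^bsub>G\<^esub> inv\<^bsub>G\<^esub> a [^]\<^bsub>G\<^esub> j) =
        b [^]\<^bsub>G\<^esub> (k + bs_unit n j) \<otimes>\<^bsub>G\<^esub> inv\<^bsub>G\<^esub> a [^]\<^bsub>G\<^esub> j"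
      using ab by (simp add: int_pow_mult m_assoc)
    finally show ?thesis
      by (simp add: m gen_b bs_word del: bs_word.simps)
  qed
qed

section \<open>Digits of integers\<close>

text \<open>The carry rule for adding \<open>1\<close>: the stated quotient and remainder recombine
  to \<open>x + 1\<close>, and the remainder lies in range.\<close>

lemma successor_div_mod:
  fixes q x :: int
  assumes "q \<ge> 2"
  shows "(x + 1) div q = x div q + (if x mod q = q - 1 then 1 else 0)"
    and "(x + 1) mod q = (if x mod q = q - 1 then 0 else x mod q + 1)"
proof -
  let ?c = "x mod q = q - 1"
  have "x + 1 = q * (x div q + (if ?c then 1 else 0)) + (if ?c then 0 else x mod q + 1)"
  proof (cases ?c)
    case True
    have "x + 1 = q * (x div q) + x mod q + 1"
      by simp
    also have "\<dots> = q * (x div q + 1)"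
      unfolding True by (simp add: distrib_left)
    finally show ?thesis
      using True by simp
  qed simp
  moreover have "0 \<le> (if ?c then 0 else x mod q + 1)" "(if ?c then 0 else x mod q + 1) < q"
  proof -
    have "x mod q + 1 < q" if "\<not> ?c"
      using pos_mod_bound[of q x] assms that by linarith
    then show "0 \<le> (if ?c then 0 else x mod q + 1)" "(if ?c then 0 else x mod q + 1) < q"
      using assms by simp_all
  qed
  ultimately show "(x + 1) div q = x div q + (if ?c then 1 else 0)"
      "(x + 1) mod q = (if ?c then 0 else x mod q + 1)"
    by (rule int_div_pos_eq, rule int_mod_pos_eq)
qed

definition digit :: "int \<Rightarrow> int \<Rightarrow> nat \<Rightarrow> int" where
  "digit q k p = k div q ^ p mod q"

lemma div_power_Suc: "q > 0 \<Longrightarrow> k div q ^ Suc p = k div q ^ p div q" for q k :: int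
  by (simp only: power_Suc2 zdiv_zmult2_eq less_imp_le)

lemma digit_Suc: "q > 0 \<Longrightarrow> digit q k (Suc p) = digit q (k div q) p"
  by (simp add: digit_def zdiv_zmult2_eq)

lemma digit_bounds: "q > 0 \<Longrightarrow> 0 \<le> digit q k p" "q > 0 \<Longrightarrow> digit q k p < q"
  by (simp_all add: digit_def)

lemma power_exceeds:
  fixes q :: int
  assumes "q \<ge> 2"
  shows "\<bar>k\<bar> < q ^ nat \<bar>k\<bar>"
proof -
  have "int (nat \<bar>k\<bar>) < int (2 ^ nat \<bar>k\<bar>)"
    by (simp only: of_nat_less_iff less_exp)
  then have "\<bar>k\<bar> < 2 ^ nat \<bar>k\<bar>"
    by simp
  also have "(2 :: int) ^ nat \<bar>k\<bar> \<le> q ^ nat \<bar>k\<bar>"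
    using assms by (intro power_mono) auto
  finally show ?thesis .
qed

text \<open>Equal digits give congruence modulo every power of \<open>q\<close>, and some power
  exceeds the absolute value of \<open>k - l\<close>.\<close>

lemma digit_inject:
  assumes "q \<ge> 2" and eq: "\<And>p. digit q k p = digit q l p"
  shows "k = l"
proof -
  have mod: "k mod q ^ p = l mod q ^ p" for p
  proof (induction p)
    case (Suc p)
    have "x mod q ^ Suc p = q ^ p * digit q x p + x mod q ^ p" for x
      using zmod_zmult2_eq[of q x "q ^ p"] assms(1) by (simp add: digit_def mult.commute)
    then show ?case using Suc eq by simp
  qed simp
  let ?p = "nat \<bar>k - l\<bar>"
  have "q ^ ?p dvd k - l"
    using mod[of ?p] by (simp add: mod_eq_dvd_iff)
  then show ?thesis
    using power_exceeds[OF assms(1), of "k - l"] zdvd_imp_le[of "q ^ ?p" "\<bar>k - l\<bar>"] by fastforce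
qed

text \<open>Horner's scheme from the constant tail downwards: the tail \<open>0\<close> belongs to
  \<open>0\<close>, the tail \<open>q - 1\<close> to \<open>-1\<close>.\<close>

lemma digit_exists:
  assumes q: "q \<ge> 2" and c: "c = 0 \<or> c = q - 1"
    and d: "\<And>p. p \<ge> N \<Longrightarrow> d p = c" "\<And>p. 0 \<le> d p" "\<And>p. d p < q"
  shows "\<exists>k. \<forall>p. digit q k p = d p"
  using d
proof (induction N arbitrary: d)
  case 0
  have "digit q 0 p = 0" "digit q (-1) p = q - 1" for p
    using q by (simp_all add: digit_def div_eq_minus1 zmod_minus1)
  then show ?case using c 0 by auto
next
  case (Suc N)
  have "\<exists>k. \<forall>p. digit q k p = d (Suc p)"
    using Suc.prems by (intro Suc.IH) auto
  then obtain k where k: "\<And>p. digit q k p = d (Suc p)"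
    by blast
  have "(d 0 + q * k) div q = k" "(d 0 + q * k) mod q = d 0"
    using Suc.prems(2,3)[of 0] q by simp_all
  then have "digit q (d 0 + q * k) p = d p" for p
    using q k by (cases p) (simp_all add: digit_Suc, simp add: digit_def)
  then show ?case by blast
qed

text \<open>Once \<open>q ^ p\<close> exceeds the absolute value of \<open>k\<close>, the rounded
  quotient is \<open>0\<close> or \<open>-1\<close>.\<close>

lemma digit_eventually:
  assumes "q \<ge> 2"
  shows "\<exists>N c. (c = 0 \<or> c = q - 1) \<and> (\<forall>p\<ge>N. digit q k p = c)"
proof -
  have "digit q k p = (if k \<ge> 0 then 0 else q - 1)" if "p \<ge> nat \<bar>k\<bar>" for p
  proof -
    have "q ^ nat \<bar>k\<bar> \<le> q ^ p"
      using that assms by (intro power_increasing) auto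
    then have "\<bar>k\<bar> < q ^ p"
      using power_exceeds[OF assms, of k] by linarith
    then have "k div q ^ p = (if k \<ge> 0 then 0 else - 1)"
      using int_div_pos_eq[of k "q ^ p" "- 1" "k + q ^ p"] by (auto intro!: div_pos_pos_trivial)
    then show ?thesis
      using assms by (simp add: digit_def zmod_minus1)
  qed
  then show ?thesis
    by (metis (full_types))
qed

section \<open>Adding a power of the base\<close>

definition increments :: "int \<Rightarrow> int \<Rightarrow> int \<Rightarrow> bool" where
  "increments q d e \<longleftrightarrow> e = (if d = q - 1 then 0 else d + 1)"

text \<open>From position \<open>J\<close> on the quotients by \<open>q ^ p\<close> differ by
  \<open>1\<close> or \<open>0\<close>. A carry out of a position is visible in the two digits
  there, so no separate carry track is needed.\<close>

lemma digit_add_power: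
  assumes q: "q \<ge> 2"
  shows "p < J \<Longrightarrow> digit q (k + q ^ J) p = digit q k p"
    and "increments q (digit q k J) (digit q (k + q ^ J) J)"
    and "J \<le> p \<Longrightarrow> if digit q k p = q - 1 \<and> digit q (k + q ^ J) p = 0
      then increments q (digit q k (Suc p)) (digit q (k + q ^ J) (Suc p))
      else digit q (k + q ^ J) (Suc p) = digit q k (Suc p)"
proof -
  let ?K = "\<lambda>p. k div q ^ p" and ?L = "\<lambda>p. (k + q ^ J) div q ^ p"
  have J: "?L J = ?K J + 1"
    using q by simp
  show "digit q (k + q ^ J) p = digit q k p" if "p < J"
  proof -
    have "q ^ J = q ^ p * (q * q ^ (J - Suc p))"
      using that by (metis Suc_diff_Suc power_Suc power_add le_add_diff_inverse less_imp_le)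
    then have "?L p = ?K p + q * q ^ (J - Suc p)"
      using q by simp
    then show ?thesis
      by (simp add: digit_def)
  qed
  have inc: "increments q (digit q k p) (digit q (k + q ^ J) p)" if "?L p = ?K p + 1" for p
    using successor_div_mod(2)[OF q, of "?K p"] that by (simp add: increments_def digit_def)
  show "increments q (digit q k J) (digit q (k + q ^ J) J)"
    using inc J by blast
  have carry: "?L (Suc p) = ?K (Suc p) + (if digit q k p = q - 1 then 1 else 0)" if "?L p = ?K p + 1" for p
    using successor_div_mod(1)[OF q, of "?K p"] that q
    by (simp only: div_power_Suc digit_def)
  have no_carry: "?L (Suc p) = ?K (Suc p)" if "?L p = ?K p" for p
    using that q by (simp only: div_power_Suc)
  have "?L p = ?K p + 1 \<or> ?L p = ?K p" if "J \<le> p" for p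
    using that
  proof (induction p rule: dec_induct)
    case base
    then show ?case using J by blast
  next
    case (step p)
    then show ?case using carry[of p] no_carry[of p] by (auto simp del: power_Suc split: if_splits)
  qed
  moreover assume "J \<le> p"
  ultimately consider "?L p = ?K p + 1" | "?L p = ?K p"
    by blast
  then show "if digit q k p = q - 1 \<and> digit q (k + q ^ J) p = 0
      then increments q (digit q k (Suc p)) (digit q (k + q ^ J) (Suc p))
      else digit q (k + q ^ J) (Suc p) = digit q k (Suc p)"
  proof cases
    \<comment> \<open>The old digit is \<open>q - 1\<close> exactly when the new one is
      \<open>0\<close>, which is when the carry continues.\<close>
    case 1
    then show ?thesis
      using carry[OF 1] inc[OF 1] inc[of "Suc p"] by (auto simp: increments_def digit_def)
  next
    \<comment> \<open>Equal digits cannot be \<open>q - 1\<close> and \<open>0\<close>, because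
      \<open>q \<ge> 2\<close>.\<close>
    case 2
    then have "digit q (k + q ^ J) p = digit q k p" "digit q (k + q ^ J) (Suc p) = digit q k (Suc p)"
      using no_carry[OF 2] by (simp_all only: digit_def)
    then show ?thesis
      using q by auto
  qed
qed

section \<open>Sequences encoding normal forms\<close>

text \<open>For \<open>n \<ge> 2\<close> multiplication by \<open>n\<close> shifts the digits; the
  bound \<open>2\<close> provides digits also for \<open>n = 0\<close> and
  \<open>n = 1\<close>.\<close>

definition bs_base :: "nat \<Rightarrow> int" where
  "bs_base n = max 2 (int n)"

lemma bs_base_ge: "bs_base n \<ge> 2" "bs_base n > 0"
  by (simp_all add: bs_base_def)

fun bs_seq :: "nat \<Rightarrow> nat \<times> int \<times> nat \<Rightarrow> nat \<Rightarrow> bool \<times> bool \<times> int" where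
  "bs_seq n (i, k, j) p = (p < i, p < j, digit (bs_base n) k p)"

definition bs_limit :: "nat \<Rightarrow> bool \<times> bool \<times> int \<Rightarrow> bool" where
  "bs_limit n x \<longleftrightarrow> x = (False, False, 0) \<or> x = (False, False, bs_base n - 1)"

text \<open>Both flags must mark initial segments. The first letter carries the divisibility
  condition: \<open>i0\<close> and \<open>j0\<close> say that the exponents are positive, and
  \<open>d0 = 0\<close> tests divisibility for \<open>n \<ge> 2\<close>; for smaller
  \<open>n\<close> divisibility is automatic, as \<open>k = 0\<close> when
  \<open>n = 0\<close>.\<close>

fun bs_valid :: "nat \<Rightarrow> bool \<times> bool \<times> int \<Rightarrow> bool \<times> bool \<times> int \<Rightarrow> bool \<times> bool \<times> int \<Rightarrow> bool" where
  "bs_valid n (i0, j0, d0) (i, j, d) (i', j', d') \<longleftrightarrow>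
     (i' \<longrightarrow> i) \<and> (j' \<longrightarrow> j) \<and> \<not> (i0 \<and> j0 \<and> (n \<ge> 2 \<longrightarrow> d0 = 0)) \<and> (n = 0 \<longrightarrow> d = 0)"

lemma antitone_flag:
  fixes f :: "nat \<Rightarrow> bool"
  assumes "\<And>p. f (Suc p) \<Longrightarrow> f p" "\<not> f N"
  shows "\<exists>i. \<forall>p. f p \<longleftrightarrow> p < i"
proof -
  define i where "i = (LEAST p. \<not> f p)"
  have "\<not> f i"
    unfolding i_def using assms(2) by (rule LeastI)
  moreover have "f p" if "f q" "p \<le> q" for p q
    using that(2,1) by (induction rule: inc_induct) (auto intro: assms(1))
  ultimately have "f p \<longleftrightarrow> p < i" for p
    unfolding i_def by (meson not_less_Least not_less)
  then show ?thesis by blast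
qed

lemma dvd_iff_digit:
  assumes "n = 0 \<longrightarrow> k = 0"
  shows "int n dvd k \<longleftrightarrow> (n \<ge> 2 \<longrightarrow> digit (bs_base n) k 0 = 0)"
proof (cases "n \<ge> 2")
  case True
  then show ?thesis by (simp add: digit_def bs_base_def dvd_eq_mod_eq_0)
next
  case False
  then consider "n = 0" | "n = 1" by linarith
  then show ?thesis using assms by cases auto
qed

text \<open>The right side has the shape of \<open>image_unfold_word\<close>, which links normal
  forms to reduced words. Conversely, flags that are eventually false give \<open>i\<close> and
  \<open>j\<close>, and the digits give \<open>k\<close>.\<close>

lemma image_bs_seq:
  "bs_seq n ` bs_normal n = {s. range s \<subseteq> UNIV \<times> UNIV \<times> {0..<bs_base n} \<and> locally (bs_valid n) s \<and>
     (\<exists>x N. bs_limit n x \<and> (\<forall>p\<ge>N. s p = x))}" (is "_ = ?S")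
proof (intro equalityI subsetI)
  fix s assume "s \<in> bs_seq n ` bs_normal n"
  then obtain i k j where m: "(i, k, j) \<in> bs_normal n" and s: "s = bs_seq n (i, k, j)"
    by auto
  obtain N c where c: "c = 0 \<or> c = bs_base n - 1" "\<forall>p\<ge>N. digit (bs_base n) k p = c"
    using digit_eventually[OF bs_base_ge(1)] by blast
  have "locally (bs_valid n) s"
  proof -
    have "n = 0 \<longrightarrow> k = 0"
      using m by (simp add: bs_normal_def)
    note dvd = dvd_iff_digit[OF this]
    have "\<not> (0 < i \<and> 0 < j \<and> (n \<ge> 2 \<longrightarrow> digit (bs_base n) k 0 = 0))"
      using m dvd unfolding bs_normal_def by blast
    moreover have "digit (bs_base n) k p = 0" if "n = 0" for p
      using m that by (simp add: bs_normal_def digit_def)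
    ultimately show ?thesis
      by (simp add: locally_def s)
  qed
  moreover have "bs_limit n (False, False, c)"
    using c(1) by (auto simp: bs_limit_def)
  moreover have "\<forall>p\<ge>max N (max i j). s p = (False, False, c)"
    using c(2) by (auto simp: s)
  moreover have "range s \<subseteq> UNIV \<times> UNIV \<times> {0..<bs_base n}"
    using digit_bounds[OF bs_base_ge(2)] by (auto simp: s)
  ultimately show "s \<in> ?S" by blast
next
  fix s assume "s \<in> ?S"
  then obtain x N where s: "range s \<subseteq> UNIV \<times> UNIV \<times> {0..<bs_base n}" "locally (bs_valid n) s"
    and x: "bs_limit n x" "\<forall>p\<ge>N. s p = x"
    by blast
  obtain f g d where fgd: "s = (\<lambda>p. (f p, g p, d p))"
    using that[of "fst \<circ> s" "fst \<circ> snd \<circ> s" "snd \<circ> snd \<circ> s"] by auto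
  have valid: "f (Suc p) \<Longrightarrow> f p" "g (Suc p) \<Longrightarrow> g p"
      "\<not> (f 0 \<and> g 0 \<and> (n \<ge> 2 \<longrightarrow> d 0 = 0))" "n = 0 \<longrightarrow> d p = 0" for p
    using s(2) unfolding locally_def fgd by auto
  obtain c where c: "c = 0 \<or> c = bs_base n - 1" "x = (False, False, c)"
    using x(1) by (auto simp: bs_limit_def)
  have lim: "\<not> f N" "\<not> g N" "\<And>p. p \<ge> N \<Longrightarrow> d p = c"
    using x(2) by (auto simp: fgd c(2))
  obtain i where i: "\<And>p. f p \<longleftrightarrow> p < i"
    using antitone_flag[of f N] valid(1) lim(1) by blast
  obtain j where j: "\<And>p. g p \<longleftrightarrow> p < j"
    using antitone_flag[of g N] valid(2) lim(2) by blast
  have "0 \<le> d p" "d p < bs_base n" for p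
    using s(1) unfolding fgd by (auto simp: image_subset_iff)
  then have "\<exists>k. \<forall>p. digit (bs_base n) k p = d p"
    using c(1) lim(3) by (intro digit_exists[OF bs_base_ge(1)]) auto
  then obtain k where k: "\<And>p. digit (bs_base n) k p = d p"
    by blast
  have k0: "n = 0 \<longrightarrow> k = 0"
  proof (intro impI, rule digit_inject[OF bs_base_ge(1)[of n]])
    show "digit (bs_base n) k p = digit (bs_base n) 0 p" if "n = 0" for p
      unfolding k using valid(4)[of p] that by (simp add: digit_def)
  qed
  note dvd = dvd_iff_digit[OF k0]
  have "\<not> (0 < i \<and> 0 < j \<and> int n dvd k)"
    unfolding dvd k i[symmetric] j[symmetric] by (rule valid(3))
  then have "(i, k, j) \<in> bs_normal n"
    using k0 by (auto simp: bs_normal_def)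
  moreover have "s = bs_seq n (i, k, j)"
    by (auto simp: fgd i j k)
  ultimately show "s \<in> bs_seq n ` bs_normal n" by blast
qed

lemma inj_bs_seq: "inj (bs_seq n)"
proof (rule injI)
  fix m m' assume eq: "bs_seq n m = bs_seq n m'"
  obtain i k j i' k' j' where m: "m = (i, k, j)" "m' = (i', k', j')"
    by (cases m, cases m')
  have "p < i \<longleftrightarrow> p < i'" "p < j \<longleftrightarrow> p < j'" "digit (bs_base n) k p = digit (bs_base n) k' p" for p
    using fun_cong[OF eq, of p] by (simp_all add: m)
  then show "m = m'"
    unfolding m using digit_inject[OF bs_base_ge(1)] by (metis linorder_neqE_nat less_irrefl)
qed

section \<open>Local rules for multiplication by the generators\<close>

text \<open>
  An addition carries out of a position iff the digit there changes from the largest one to \<open>0\<close>. It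
  starts at position \<open>j\<close>; only for \<open>n = 1\<close>, where \<open>n\<^sup>j = 1\<close> but the base is \<open>2\<close>, it starts at position \<open>0\<close>.
\<close>
fun bs_edge :: "nat \<Rightarrow> bs_gen \<Rightarrow> (bool \<times> bool \<times> int) \<times> (bool \<times> bool \<times> int) \<Rightarrow>
    (bool \<times> bool \<times> int) \<times> (bool \<times> bool \<times> int) \<Rightarrow> (bool \<times> bool \<times> int) \<times> (bool \<times> bool \<times> int) \<Rightarrow> bool" where
  "bs_edge n gen_a ((f0, g0, d0), (f0', g0', d0')) ((f, g, d), (f', g', d')) ((f1, g1, d1), (f1', g1', d1')) \<longleftrightarrow>
     (if g0 then f' = f \<and> d' = d \<and> g' = g1
      else f0' \<and> \<not> g' \<and> f1' = f \<and> (if n \<ge> 2 then d0' = 0 \<and> d1' = d else d' = d))"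
| "bs_edge n gen_b ((f0, g0, d0), (f0', g0', d0')) ((f, g, d), (f', g', d')) ((f1, g1, d1), (f1', g1', d1')) \<longleftrightarrow>
     f' = f \<and> g' = g \<and>
     (if n = 1 \<or> n \<ge> 2 \<and> \<not> g0 then increments (bs_base n) d0 d0' else d0' = d0) \<and>
     (if d = bs_base n - 1 \<and> d' = 0 \<or> n \<ge> 2 \<and> g \<and> \<not> g1 then increments (bs_base n) d1 d1' else d1' = d1)"

text \<open>Each letter of the second sequence is forced by the first sequence and, for
  \<open>gen_b\<close>, by the digit before. Hence verifying the rules for the true product also
  excludes every other sequence.\<close>

lemma bs_edge_functional:
  assumes "locally (bs_edge n x) (\<lambda>p. (s p, t p))" "locally (bs_edge n x) (\<lambda>p. (s p, u p))"
  shows "t = u"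
proof -
  obtain f g d where s: "s = (\<lambda>p. (f p, g p, d p))"
    using that[of "fst \<circ> s" "fst \<circ> snd \<circ> s" "snd \<circ> snd \<circ> s"] by auto
  obtain f1 g1 d1 where t: "t = (\<lambda>p. (f1 p, g1 p, d1 p))"
    using that[of "fst \<circ> t" "fst \<circ> snd \<circ> t" "snd \<circ> snd \<circ> t"] by auto
  obtain f2 g2 d2 where u: "u = (\<lambda>p. (f2 p, g2 p, d2 p))"
    using that[of "fst \<circ> u" "fst \<circ> snd \<circ> u" "snd \<circ> snd \<circ> u"] by auto
  show ?thesis
  proof (cases x)
    case gen_a
    note edge = assms[unfolded locally_def gen_a, THEN spec]
    have "t p = u p" for p
    proof (cases p)
      case 0
      then show ?thesis
        using edge(1)[of 0] edge(2)[of 0] by (auto simp: s t u split: if_splits)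
    next
      case (Suc p')
      then show ?thesis
        using edge(1)[of p] edge(2)[of p] edge(1)[of p'] edge(2)[of p'] by (auto simp: s t u split: if_splits)
    qed
    then show ?thesis by blast
  next
    case gen_b
    note edge = assms[unfolded locally_def gen_b, THEN spec]
    have "f1 p = f2 p" "g1 p = g2 p" for p
      using edge(1)[of p] edge(2)[of p] by (auto simp: s t u)
    moreover have "d1 p = d2 p" for p
    proof (induction p)
      case 0
      show ?case
        using edge(1)[of 0] edge(2)[of 0] unfolding s t u bs_edge.simps increments_def by argo
    next
      case (Suc p)
      then show ?case
        using edge(1)[of p] edge(2)[of p] unfolding s t u bs_edge.simps increments_def by metis
    qed
    ultimately show ?thesis
      by (simp add: t u)
  qed
qed

lemma bs_edge_act:
  assumes "m \<in> bs_normal n"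
  shows "locally (bs_edge n x) (\<lambda>p. (bs_seq n m p, bs_seq n (bs_act n (Gen x) m) p))"
proof -
  obtain i k j where m: "m = (i, k, j)" by (cases m)
  let ?q = "bs_base n"
  note q = bs_base_ge[of n]
  have k0: "n = 0 \<longrightarrow> k = 0"
    using assms by (simp add: m bs_normal_def)
  consider "x = gen_a" "j > 0" | "x = gen_a" "j = 0" | "x = gen_b" "n = 0" | "x = gen_b" "n > 0"
    by (cases x) auto
  then show ?thesis
  proof cases
    case 1
    then show ?thesis by (auto simp: locally_def m)
  next
    case 2
    \<comment> \<open>For \<open>n \<ge> 2\<close> the digits shift by one place; otherwise the
      exponent does not change.\<close>
    have "digit ?q (int n * k) 0 = 0" "digit ?q (int n * k) (Suc p) = digit ?q k p" if "n \<ge> 2" for p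
      using that q by (simp_all add: digit_Suc) (simp_all add: digit_def bs_base_def)
    moreover have "int n * k = k" if small: "\<not> n \<ge> 2"
    proof -
      consider "n = 0" | "n = 1" using small by linarith
      then show ?thesis using k0 by cases auto
    qed
    ultimately show ?thesis
      using 2 by (auto simp: locally_def m)
  next
    case 3
    then show ?thesis using q by (auto simp: locally_def m bs_unit_def)
  next
    case 4
    \<comment> \<open>The position where the addition starts.\<close>
    define J where "J = (if n = 1 then 0 else j)"
    have unit: "bs_unit n j = ?q ^ J"
      using 4 by (auto simp: bs_unit_def bs_base_def J_def max_def)
    \<comment> \<open>Unchanged digits below \<open>J\<close> cannot simulate a carry.\<close>
    have "p < J \<Longrightarrow> \<not> (digit ?q k p = ?q - 1 \<and> digit ?q (k + ?q ^ J) p = 0)" for p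
      using digit_add_power(1)[OF q(1), of p J k] q by simp
    note add = this digit_add_power[OF q(1), where J = J and k = k]
    have first: "if n = 1 \<or> n \<ge> 2 \<and> \<not> 0 < j then increments ?q (digit ?q k 0) (digit ?q (k + ?q ^ J) 0)
        else digit ?q (k + ?q ^ J) 0 = digit ?q k 0"
      using add(2)[of 0] add(3) 4 by (auto simp: J_def split: if_splits)
    have next_digit: "if digit ?q k p = ?q - 1 \<and> digit ?q (k + ?q ^ J) p = 0 \<or> n \<ge> 2 \<and> p < j \<and> \<not> Suc p < j
        then increments ?q (digit ?q k (Suc p)) (digit ?q (k + ?q ^ J) (Suc p))
        else digit ?q (k + ?q ^ J) (Suc p) = digit ?q k (Suc p)" for p
    proof -
      \<comment> \<open>At or above \<open>J\<close> the carry rule decides; at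
        \<open>Suc p = J\<close> the end of the \<open>j\<close> flags starts the addition; below
        that nothing changes.\<close>
      consider "J \<le> p" | "Suc p = J" | "Suc p < J" by linarith
      then show ?thesis
      proof cases
        case 1
        then have "\<not> (n \<ge> 2 \<and> p < j \<and> \<not> Suc p < j)"
          by (auto simp: J_def split: if_splits)
        then show ?thesis using add(4)[OF 1] by argo
      next
        case 2
        then have "n \<ge> 2 \<and> p < j \<and> \<not> Suc p < j"
          using \<open>n > 0\<close> by (auto simp: J_def split: if_splits)
        then show ?thesis using add(3) 2 by simp
      next
        case 3
        then have "\<not> (n \<ge> 2 \<and> p < j \<and> \<not> Suc p < j)"
          by (auto simp: J_def split: if_splits)
        then show ?thesis using add(1)[of p] add(2)[of "Suc p"] 3 by auto
      qed
    qed
    show ?thesis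
      unfolding locally_def m 4 bs_act.simps bs_seq.simps bs_edge.simps unit
      using first next_digit by blast
  qed
qed

lemma locally_bs_edge_iff:
  assumes "m \<in> bs_normal n"
  shows "locally (bs_edge n x) (\<lambda>p. (bs_seq n m p, bs_seq n m' p)) \<longleftrightarrow> bs_act n (Gen x) m = m'"
proof
  assume "locally (bs_edge n x) (\<lambda>p. (bs_seq n m p, bs_seq n m' p))"
  then have "bs_seq n (bs_act n (Gen x) m) = bs_seq n m'"
    using bs_edge_functional bs_edge_act[OF assms, of x] by blast
  then show "bs_act n (Gen x) m = m'"
    by (rule injD[OF inj_bs_seq])
qed (use bs_edge_act[OF assms] in blast)

section \<open>Transport to reduced words over a numerical alphabet\<close>

theorem theorem13p1:
  fixes n :: nat
  shows "graph_automatic (Baumslag_Solitar 1 n)"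
proof -
  let ?S = "bs_relators n" and ?M = "bs_normal n" and ?q = "bs_base n"
  let ?A = "UNIV \<times> UNIV \<times> {0..<?q} :: (bool \<times> bool \<times> int) set"
  define G where "G = presented_group ?S"
  interpret group G
    unfolding G_def by (rule group_presented_group)
  define \<phi> where "\<phi> m = word_class ?S (bs_word m)" for m
  define X where "X = range (\<lambda>x. word_class ?S [Gen x])"
  have "bij_betw \<phi> ?M (carrier G)"
    unfolding \<phi>_def G_def
  proof (rule bij_betw_presented_group[where f = "bs_act n" and z = "(0, 0, 0)"])
    show "(0, 0, 0) \<in> ?M" "bs_word (0, 0, 0) = []"
      by (simp_all add: bs_normal_def bs_power_def)
  qed (erule bs_act_in bs_act_inverse act_bs_word bs_word_equivariant | erule (1) bs_act_relators)+
  note bij_\<phi> = this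

  \<comment> \<open>Letters must be natural numbers, so triples are numbered by
    \<open>to_nat\<close> and all conditions are pulled back along \<open>from_nat\<close>.\<close>
  define enc where "enc s = to_nat \<circ> s" for s :: "nat \<Rightarrow> bool \<times> bool \<times> int"
  define \<Sigma> where "\<Sigma> = to_nat ` ?A"
  define B where "B = bs_limit n \<circ> from_nat"
  define \<Psi> where "\<Psi> x y z = bs_valid n (from_nat x) (from_nat y) (from_nat z)" for x y z
  define R where "R = reduced_words \<Sigma> B \<Psi>"
  have fin: "finite \<Sigma>"
    by (simp add: \<Sigma>_def)
  have inj_enc: "inj enc"
    by (rule injI) (simp add: enc_def fun_eq_iff)
  let ?T = "{s. range s \<subseteq> ?A \<and> locally (bs_valid n) s \<and> (\<exists>x N. bs_limit n x \<and> (\<forall>p\<ge>N. s p = x))}"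
  let ?U = "{t. range t \<subseteq> \<Sigma> \<and> locally \<Psi> t \<and> (\<exists>x N. B x \<and> (\<forall>p\<ge>N. t p = x))}"
  have "?U = enc ` ?T"
  proof (intro equalityI subsetI)
    fix t assume "t \<in> ?U"
    then obtain x N where t: "range t \<subseteq> \<Sigma>" "locally \<Psi> t" "B x" "\<forall>p\<ge>N. t p = x"
      by blast
    \<comment> \<open>Decoding is inverted by \<open>to_nat\<close> only on the codes of triples,
      hence the appeal to \<open>\<Sigma>\<close>.\<close>
    have dec: "from_nat (t p) \<in> ?A" "to_nat (from_nat (t p) :: bool \<times> bool \<times> int) = t p" for p
    proof -
      have "t p \<in> to_nat ` ?A"
        using t(1) unfolding \<Sigma>_def by (rule subsetD) (rule rangeI)
      then obtain y where "y \<in> ?A" "t p = to_nat y"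
        by (rule imageE)
      then show "from_nat (t p) \<in> ?A" "to_nat (from_nat (t p) :: bool \<times> bool \<times> int) = t p"
        by (simp_all only: from_nat_to_nat)
    qed
    have "t = enc (from_nat \<circ> t)"
      unfolding enc_def comp_def by (simp only: dec(2))
    moreover have "from_nat \<circ> t \<in> ?T"
    proof (intro CollectI conjI exI)
      show "range (from_nat \<circ> t) \<subseteq> ?A"
        by (rule image_subsetI) (simp only: comp_def dec(1))
      show "locally (bs_valid n) (from_nat \<circ> t)"
        using t(2) by (simp add: locally_def \<Psi>_def)
      show "bs_limit n (from_nat x)" "\<forall>p\<ge>N. (from_nat \<circ> t) p = from_nat x"
        using t(3,4) by (simp_all add: B_def)
    qed
    ultimately show "t \<in> enc ` ?T"
      by (rule image_eqI)
  next
    fix t assume "t \<in> enc ` ?T"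
    then obtain s x N where s: "t = enc s" "range s \<subseteq> ?A" "locally (bs_valid n) s"
        "bs_limit n x" "\<forall>p\<ge>N. s p = x"
      by blast
    show "t \<in> ?U"
      unfolding s(1)
    proof (intro CollectI conjI exI)
      show "range (enc s) \<subseteq> \<Sigma>"
        unfolding enc_def \<Sigma>_def image_comp[symmetric] using s(2) by (rule image_mono)
      show "locally \<Psi> (enc s)"
        using s(3) by (simp add: locally_def \<Psi>_def enc_def)
      show "B (to_nat x)" "\<forall>p\<ge>N. enc s p = to_nat x"
        using s(4,5) by (simp_all add: B_def enc_def)
    qed
  qed
  then have image_R: "unfold_word ` R = (enc \<circ> bs_seq n) ` ?M"
    unfolding R_def image_unfold_word image_comp[symmetric] image_bs_seq .
  have inj_seq: "inj_on (enc \<circ> bs_seq n) ?M"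
    using inj_compose[OF inj_enc inj_bs_seq] by (rule inj_on_subset) simp
  \<comment> \<open>The normal form whose encoding \<open>u\<close> represents.\<close>
  define \<mu> where "\<mu> u = inv_into ?M (enc \<circ> bs_seq n) (unfold_word u)" for u
  have \<mu>: "\<mu> u \<in> ?M" "unfold_word u = enc (bs_seq n (\<mu> u))" if "u \<in> R" for u
  proof -
    have u: "unfold_word u \<in> (enc \<circ> bs_seq n) ` ?M"
      using that image_R by blast
    show "\<mu> u \<in> ?M"
      unfolding \<mu>_def by (rule inv_into_into[OF u])
    show "unfold_word u = enc (bs_seq n (\<mu> u))"
      unfolding \<mu>_def using f_inv_into_f[OF u] by simp
  qed
  have "bij_betw unfold_word R ((enc \<circ> bs_seq n) ` ?M)"
    unfolding bij_betw_def image_R using inj_on_unfold_word by (simp add: R_def)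
  moreover have "bij_betw (inv_into ?M (enc \<circ> bs_seq n)) ((enc \<circ> bs_seq n) ` ?M) ?M"
    by (intro bij_betw_inv_into inj_on_imp_bij_betw inj_seq)
  ultimately have "bij_betw \<mu> R ?M"
    unfolding \<mu>_def by (rule bij_betw_trans[unfolded comp_def])
  then have bij: "bij_betw (\<phi> \<circ> \<mu>) R (carrier G)"
    using bij_\<phi> by (rule bij_betw_trans)
  have reg: "regular \<Sigma> R"
    unfolding R_def by (rule regular_reduced_words[OF fin])
  have FA: "FA_recognizable \<Sigma> 2
      {[u, v] | u v. u \<in> R \<and> v \<in> R \<and> (\<phi> \<circ> \<mu>) u \<otimes>\<^bsub>G\<^esub> word_class ?S [Gen x] = (\<phi> \<circ> \<mu>) v}" for x
  proof -
    define \<Phi> where "\<Phi> a b c = bs_edge n x (map_prod from_nat from_nat a) (map_prod from_nat from_nat b)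
      (map_prod from_nat from_nat c)" for a b c
    \<comment> \<open>An edge of the Cayley graph is a step of \<open>bs_act\<close> between normal
      forms, which the local rules express on the encodings.\<close>
    have "(\<phi> \<circ> \<mu>) u \<otimes>\<^bsub>G\<^esub> word_class ?S [Gen x] = (\<phi> \<circ> \<mu>) v \<longleftrightarrow>
        locally \<Phi> (\<lambda>p. (unfold_word u p, unfold_word v p))" if "u \<in> R" "v \<in> R" for u v
    proof -
      have "(\<phi> \<circ> \<mu>) u \<otimes>\<^bsub>G\<^esub> word_class ?S [Gen x] = \<phi> (bs_act n (Gen x) (\<mu> u))"
        unfolding \<phi>_def G_def comp_def word_class_append[symmetric]
        by (rule bs_word_equivariant[OF \<mu>(1)[OF that(1)]])
      also have "\<dots> = (\<phi> \<circ> \<mu>) v \<longleftrightarrow> bs_act n (Gen x) (\<mu> u) = \<mu> v"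
        using inj_on_eq_iff[OF bij_betw_imp_inj_on[OF bij_\<phi>] bs_act_in[OF \<mu>(1)[OF that(1)]] \<mu>(1)[OF that(2)]]
        by simp
      also have "\<dots> \<longleftrightarrow> locally \<Phi> (\<lambda>p. (unfold_word u p, unfold_word v p))"
        unfolding locally_bs_edge_iff[OF \<mu>(1)[OF that(1)], symmetric] \<mu>(2)[OF that(1)] \<mu>(2)[OF that(2)]
        by (simp add: locally_def \<Phi>_def enc_def)
      finally show ?thesis .
    qed
    then have "{[u, v] | u v. u \<in> R \<and> v \<in> R \<and> (\<phi> \<circ> \<mu>) u \<otimes>\<^bsub>G\<^esub> word_class ?S [Gen x] = (\<phi> \<circ> \<mu>) v} =
        {[u, v] | u v. u \<in> R \<and> v \<in> R \<and> locally \<Phi> (\<lambda>p. (unfold_word u p, unfold_word v p))}"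
      by blast
    moreover have "[] \<notin> R"
      by (simp add: R_def reduced_words_def)
    ultimately show ?thesis
      using FA_recognizable_locally[OF reg] by simp
  qed
  have "(UNIV :: bs_gen set) = {gen_a, gen_b}"
    by (auto intro: bs_gen.exhaust)
  then have "finite X"
    unfolding X_def by (metis finite.emptyI finite.insertI finite_imageI)
  moreover have "X \<subseteq> carrier G" "generate G X = carrier G"
    unfolding X_def G_def generate_presented_group by (auto simp: carrier_presented_group)
  ultimately have "graph_automatic_wrt G X"
    unfolding graph_automatic_wrt_def using group_axioms fin reg bij FA unfolding X_def by blast
  then show ?thesis
    unfolding graph_automatic_def Baumslag_Solitar_1_eq G_def by blast
qed

end
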